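(* (a) Let $(B,C)$ be a contact algebra and let $(X,X_0)$ be its canonical 2-contact space. Then the function $g_B$, $g_B(a)=\{\Gamma\in X\mid a\in\Gamma\}$ for $a\in B$, is a CA-isomorphism from $(B,C)$ onto the canonical contact algebra $(RC(X,X_0),C_{(X,X_0)})$ of $(X,X_0)$. The sets $RC(X,X_0)$ and $RC(X)$ coincide iff the contact algebra $(B,C)$ is complete. The contact algebra $(B,C)$ is connected iff the 2-contact space $(X,X_0)$ is connected. (b) There exists a bijective correspondence between the class of all, up to CA-isomorphism, contact algebras and the class of all, up to CS-isomorphism, 2-contact spaces, and likewise between the class of all, up to CA-isomorphism, connected contact algebras and the class of all, up to CS-isomorphism, connected 2-contact spaces. Namely, for every (connected) contact algebra $\underline B$, its CA-isomorphism class $[\underline B]$ corresponds to the CS-isomorphism class of its canonical 2-contact space, and for every (connected) 2-contact space $(X,X_0)$, its CS-isomorphism class $[(X,X_0)]$ corresponds to the CA-isomorphism class of its canonical contact algebra.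
   Context: Contact algebras. A contact algebra is a pair $(B,C)$ where $B=(B,0,1,+,\cdot,{}^* )$ is a Boolean algebra ($0=1$ allowed) and $C$ is a binary relation on $B$ such that: $aCb$ implies $a\neq0$ and $b\neq 0$; $aC(b+c)$ iff $aCb$ or $aCc$, and $(a+b)Cc$ iff $aCc$ or $bCc$; $a\neq 0$ implies $aCa$; $aCb$ implies $bCa$. It is complete if $B$ is complete, and connected if $aCa^*$ for every $a\ne0,1$. A CA-isomorphism $(B,C)\to(B_1,C_1)$ is a Boolean isomorphism $\varphi$ with $aCb$ iff $\varphi(a)C_1\varphi(b)$. A clan of $(B,C)$ is a non-empty $\Gamma\subseteq B$ such that $0\notin\Gamma$; $a\in\Gamma$, $a\le b$ imply $b\in\Gamma$; $a+b\in\Gamma$ implies $a\in\Gamma$ or $b\in\Gamma$; and $a,b\in\Gamma$ implies $aCb$. $Clans(B,C)$ is the set of clans and $Ult(B)\subseteq Clans(B,C)$ the set of ultrafilters. Topology. $RC(X)$ is the Boolean algebra of regular closed subsets ($F=\mathrm{cl}(\mathrm{int}F)$) of a space $X$ with $a+b=a\cup b$, $a^*=\mathrm{cl}(X\setminus a)$, $a\cdot b=\mathrm{cl}(\mathrm{int}(a\cap b))$, $0=\emptyset$, $1=X$. $CO(X)$ is the Boolean algebra of clopen sets. A topological pair $(X,X_0)$ is a space $X$ with a dense subspace $X_0$; $RC(X,X_0)=\{\mathrm{cl}_X(A)\mid A\in CO(X_0)\}$, a Boolean subalgebra of $RC(X)$; for $F,G\in RC(X,X_0)$, $F\,C_{(X,X_0)}\,G$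 iff $F\cap G\ne\emptyset$. For $F,G\in CO(X_0)$, $F\,\delta_{(X,X_0)}\,G$ iff $\mathrm{cl}_X(F)\cap \mathrm{cl}_X(G)\neq\emptyset$; $(CO(X_0),\delta_{(X,X_0)})$ is a contact algebra. For $x\in X$, $\Gamma_{x,X_0}=\{F\in CO(X_0)\mid x\in \mathrm{cl}_X(F)\}$. 2-contact spaces. A topological pair $(X,X_0)$ is a 2-contact space if: (CS1) $X$ is $T_0$; (CS2) $X_0$ is a Stone space (compact Hausdorff zero-dimensional); (CS3) $RC(X,X_0)$ is a closed base for $X$; (CS4) for every $\Gamma\in Clans(CO(X_0),\delta_{(X,X_0)})$ there is $x\in X$ with $\Gamma=\Gamma_{x,X_0}$. It is connected if $X$ is connected. Its canonical contact algebra is $(RC(X,X_0),C_{(X,X_0)})$. Two 2-contact spaces $(X,X_0)$, $(\widehat X,\widehat X_0)$ are CS-isomorphic if there is a homeomorphism $f:X\to\widehat X$ with $f(X_0)=\widehat X_0$. The canonical 2-contact space of a contact algebra $(B,C)$ is $(X,X_0)$, where $X=Clans(B,C)$ with the topology having $\{g_B(a)\mid a\in B\}$ as a closed base, and $X_0=Ult(B)$ with the subspace topology; it is a 2-contact space. *)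

theory Defs
  imports "HOL-Analysis.Analysis" "HOL-Algebra.Complete_Lattice"
begin

section \<open>Contact algebras\<close>

text \<open>Boolean algebras have an explicit carrier, because the algebras attached to spaces below
  live on families of sets. The axioms are those of \<^locale>\<open>abstract_boolean_algebra\<close>,
  relativised to the carrier; the one-element algebra is allowed.\<close>

record 'a boolean_alg = "'a partial_object" +
  bzero :: 'a  (\<open>\<^bold>0\<index>\<close>)
  bone :: 'a  (\<open>\<^bold>1\<index>\<close>)
  badd :: "'a \<Rightarrow> 'a \<Rightarrow> 'a"  (infixl \<open>\<^bold>+\<index>\<close> 65)
  bmult :: "'a \<Rightarrow> 'a \<Rightarrow> 'a"  (infixl \<open>\<^bold>*\<index>\<close> 70)
  bcompl :: "'a \<Rightarrow> 'a"  (\<open>\<^bold>-\<index> _\<close> [81] 80)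

locale bool_alg =
  fixes B :: "('a, 'm) boolean_alg_scheme" (structure)
  assumes zero_closed: "\<^bold>0 \<in> carrier B"
    and one_closed: "\<^bold>1 \<in> carrier B"
    and add_closed: "\<lbrakk>a \<in> carrier B; b \<in> carrier B\<rbrakk> \<Longrightarrow> a \<^bold>+ b \<in> carrier B"
    and mult_closed: "\<lbrakk>a \<in> carrier B; b \<in> carrier B\<rbrakk> \<Longrightarrow> a \<^bold>* b \<in> carrier B"
    and compl_closed: "a \<in> carrier B \<Longrightarrow> \<^bold>- a \<in> carrier B"
    and add_assoc: "\<lbrakk>a \<in> carrier B; b \<in> carrier B; c \<in> carrier B\<rbrakk>
      \<Longrightarrow> (a \<^bold>+ b) \<^bold>+ c = a \<^bold>+ (b \<^bold>+ c)"
    and mult_assoc: "\<lbrakk>a \<in> carrier B; b \<in> carrier B; c \<in> carrier B\<rbrakk>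
      \<Longrightarrow> (a \<^bold>* b) \<^bold>* c = a \<^bold>* (b \<^bold>* c)"
    and add_commute: "\<lbrakk>a \<in> carrier B; b \<in> carrier B\<rbrakk> \<Longrightarrow> a \<^bold>+ b = b \<^bold>+ a"
    and mult_commute: "\<lbrakk>a \<in> carrier B; b \<in> carrier B\<rbrakk> \<Longrightarrow> a \<^bold>* b = b \<^bold>* a"
    and mult_add_distrib: "\<lbrakk>a \<in> carrier B; b \<in> carrier B; c \<in> carrier B\<rbrakk>
      \<Longrightarrow> a \<^bold>* (b \<^bold>+ c) = (a \<^bold>* b) \<^bold>+ (a \<^bold>* c)"
    and add_mult_distrib: "\<lbrakk>a \<in> carrier B; b \<in> carrier B; c \<in> carrier B\<rbrakk>
      \<Longrightarrow> a \<^bold>+ (b \<^bold>* c) = (a \<^bold>+ b) \<^bold>* (a \<^bold>+ c)"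
    and mult_one: "a \<in> carrier B \<Longrightarrow> a \<^bold>* \<^bold>1 = a"
    and add_zero: "a \<in> carrier B \<Longrightarrow> a \<^bold>+ \<^bold>0 = a"
    and mult_compl: "a \<in> carrier B \<Longrightarrow> a \<^bold>* \<^bold>- a = \<^bold>0"
    and add_compl: "a \<in> carrier B \<Longrightarrow> a \<^bold>+ \<^bold>- a = \<^bold>1"

definition ble :: "('a, 'm) boolean_alg_scheme \<Rightarrow> 'a \<Rightarrow> 'a \<Rightarrow> bool"
  where "ble B a b \<longleftrightarrow> a \<^bold>+\<^bsub>B\<^esub> b = b"

definition ba_order :: "('a, 'm) boolean_alg_scheme \<Rightarrow> 'a gorder"
  where "ba_order B = \<lparr>carrier = carrier B, eq = (=), le = ble B\<rparr>"

definition ba_complete :: "('a, 'm) boolean_alg_scheme \<Rightarrow> bool"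
  where "ba_complete B \<longleftrightarrow> complete_lattice (ba_order B)"

text \<open>Only the restriction of \<open>contact\<close> to the carrier is ever used.\<close>

record 'a contact_alg = "'a boolean_alg" +
  contact :: "'a \<Rightarrow> 'a \<Rightarrow> bool"

locale contact_algebra = bool_alg B for B :: "'a contact_alg" (structure) +
  assumes contact_nonzero: "\<lbrakk>a \<in> carrier B; b \<in> carrier B; contact B a b\<rbrakk>
      \<Longrightarrow> a \<noteq> \<^bold>0 \<and> b \<noteq> \<^bold>0"
    and contact_add_right: "\<lbrakk>a \<in> carrier B; b \<in> carrier B; c \<in> carrier B\<rbrakk>
      \<Longrightarrow> contact B a (b \<^bold>+ c) \<longleftrightarrow> contact B a b \<or> contact B a c"
    and contact_add_left: "\<lbrakk>a \<in> carrier B; b \<in> carrier B; c \<in> carrier B\<rbrakk>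
      \<Longrightarrow> contact B (a \<^bold>+ b) c \<longleftrightarrow> contact B a c \<or> contact B b c"
    and contact_refl: "\<lbrakk>a \<in> carrier B; a \<noteq> \<^bold>0\<rbrakk> \<Longrightarrow> contact B a a"
    and contact_sym: "\<lbrakk>a \<in> carrier B; b \<in> carrier B; contact B a b\<rbrakk> \<Longrightarrow> contact B b a"

definition ca_connected :: "'a contact_alg \<Rightarrow> bool"
  where "ca_connected B \<longleftrightarrow>
    (\<forall>a\<in>carrier B. a \<noteq> \<^bold>0\<^bsub>B\<^esub> \<and> a \<noteq> \<^bold>1\<^bsub>B\<^esub> \<longrightarrow> contact B a (\<^bold>-\<^bsub>B\<^esub> a))"

definition CA_isomorphism :: "('a \<Rightarrow> 'b) \<Rightarrow> 'a contact_alg \<Rightarrow> 'b contact_alg \<Rightarrow> bool"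
  where "CA_isomorphism \<phi> A B \<longleftrightarrow>
    bij_betw \<phi> (carrier A) (carrier B) \<and>
    \<phi> \<^bold>0\<^bsub>A\<^esub> = \<^bold>0\<^bsub>B\<^esub> \<and> \<phi> \<^bold>1\<^bsub>A\<^esub> = \<^bold>1\<^bsub>B\<^esub> \<and>
    (\<forall>a\<in>carrier A. \<forall>b\<in>carrier A.
       \<phi> (a \<^bold>+\<^bsub>A\<^esub> b) = \<phi> a \<^bold>+\<^bsub>B\<^esub> \<phi> b \<and> \<phi> (a \<^bold>*\<^bsub>A\<^esub> b) = \<phi> a \<^bold>*\<^bsub>B\<^esub> \<phi> b) \<and>
    (\<forall>a\<in>carrier A. \<phi> (\<^bold>-\<^bsub>A\<^esub> a) = \<^bold>-\<^bsub>B\<^esub> \<phi> a) \<and>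
    (\<forall>a\<in>carrier A. \<forall>b\<in>carrier A. contact A a b \<longleftrightarrow> contact B (\<phi> a) (\<phi> b))"

definition CA_isomorphic :: "'a contact_alg \<Rightarrow> 'b contact_alg \<Rightarrow> bool"
  where "CA_isomorphic A B \<longleftrightarrow> (\<exists>\<phi>. CA_isomorphism \<phi> A B)"

definition Clans :: "'a contact_alg \<Rightarrow> 'a set set"
  where "Clans B = {\<Gamma>. \<Gamma> \<subseteq> carrier B \<and> \<Gamma> \<noteq> {} \<and> \<^bold>0\<^bsub>B\<^esub> \<notin> \<Gamma> \<and>
    (\<forall>a\<in>\<Gamma>. \<forall>b\<in>carrier B. ble B a b \<longrightarrow> b \<in> \<Gamma>) \<and>
    (\<forall>a\<in>carrier B. \<forall>b\<in>carrier B. a \<^bold>+\<^bsub>B\<^esub> b \<in> \<Gamma> \<longrightarrow> a \<in> \<Gamma> \<or> b \<in> \<Gamma>) \<and>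
    (\<forall>a\<in>\<Gamma>. \<forall>b\<in>\<Gamma>. contact B a b)}"

definition proper_filter :: "('a, 'm) boolean_alg_scheme \<Rightarrow> 'a set \<Rightarrow> bool"
  where "proper_filter B F \<longleftrightarrow> F \<subseteq> carrier B \<and> F \<noteq> {} \<and> \<^bold>0\<^bsub>B\<^esub> \<notin> F \<and>
    (\<forall>a\<in>F. \<forall>b\<in>carrier B. ble B a b \<longrightarrow> b \<in> F) \<and>
    (\<forall>a\<in>F. \<forall>b\<in>F. a \<^bold>*\<^bsub>B\<^esub> b \<in> F)"

definition Ult :: "('a, 'm) boolean_alg_scheme \<Rightarrow> 'a set set"
  where "Ult B = {U. proper_filter B U \<and> (\<forall>F. proper_filter B F \<and> U \<subseteq> F \<longrightarrow> F = U)}"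

section \<open>Topological pairs and 2-contact spaces\<close>

type_synonym 'a top_pair = "'a topology \<times> 'a set"

definition topological_pair :: "'a top_pair \<Rightarrow> bool"
  where "topological_pair = (\<lambda>(X, X\<^sub>0).
    X\<^sub>0 \<subseteq> topspace X \<and> X closure_of X\<^sub>0 = topspace X)"

definition RC :: "'a topology \<Rightarrow> 'a set set"
  where "RC X = {F. F \<subseteq> topspace X \<and> F = X closure_of (X interior_of F)}"

definition CO :: "'a topology \<Rightarrow> 'a set set"
  where "CO X = {A. openin X A \<and> closedin X A}"

definition RC_pair :: "'a top_pair \<Rightarrow> 'a set set"
  where "RC_pair = (\<lambda>(X, X\<^sub>0). (\<lambda>A. X closure_of A) ` CO (subtopology X X\<^sub>0))"

text \<open>\<open>(RC(X,X\<^sub>0), C)\<close>, with the Boolean operations of \<open>RC(X)\<close>.\<close>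

definition canonical_CA :: "'a top_pair \<Rightarrow> 'a set contact_alg"
  where "canonical_CA = (\<lambda>(X, X\<^sub>0). \<lparr>
    carrier = RC_pair (X, X\<^sub>0),
    bzero = {},
    bone = topspace X,
    badd = (\<union>),
    bmult = (\<lambda>F G. X closure_of (X interior_of (F \<inter> G))),
    bcompl = (\<lambda>F. X closure_of (topspace X - F)),
    contact = (\<lambda>F G. F \<inter> G \<noteq> {})\<rparr>)"

text \<open>\<open>(CO(X\<^sub>0), \<delta>)\<close>, where \<open>X\<^sub>0\<close> carries the subspace topology.\<close>

definition clopen_CA :: "'a top_pair \<Rightarrow> 'a set contact_alg"
  where "clopen_CA = (\<lambda>(X, X\<^sub>0). \<lparr>
    carrier = CO (subtopology X X\<^sub>0),
    bzero = {},
    bone = X\<^sub>0,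
    badd = (\<union>),
    bmult = (\<inter>),
    bcompl = (\<lambda>F. X\<^sub>0 - F),
    contact = (\<lambda>F G. X closure_of F \<inter> X closure_of G \<noteq> {})\<rparr>)"

definition point_clan :: "'a top_pair \<Rightarrow> 'a \<Rightarrow> 'a set set"
  where "point_clan = (\<lambda>(X, X\<^sub>0) x. {F \<in> CO (subtopology X X\<^sub>0). x \<in> X closure_of F})"

definition Stone_space :: "'a topology \<Rightarrow> bool"
  where "Stone_space X \<longleftrightarrow> compact_space X \<and> Hausdorff_space X \<and>
    openin X = arbitrary union_of (\<lambda>U. U \<in> CO X)"

text \<open>The empty intersection is the whole space, hence the intersection with
  \<^term>\<open>topspace X\<close>.\<close>

definition closed_base :: "'a topology \<Rightarrow> 'a set set \<Rightarrow> bool"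
  where "closed_base X \<C> \<longleftrightarrow> (\<forall>F\<in>\<C>. closedin X F) \<and>
    (\<forall>F. closedin X F \<longrightarrow> (\<exists>\<G>\<subseteq>\<C>. F = topspace X \<inter> \<Inter>\<G>))"

definition two_contact_space :: "'a top_pair \<Rightarrow> bool"
  where "two_contact_space = (\<lambda>(X, X\<^sub>0).
    topological_pair (X, X\<^sub>0) \<and>
    t0_space X \<and>
    Stone_space (subtopology X X\<^sub>0) \<and>
    closed_base X (RC_pair (X, X\<^sub>0)) \<and>
    (\<forall>\<Gamma> \<in> Clans (clopen_CA (X, X\<^sub>0)). \<exists>x \<in> topspace X. \<Gamma> = point_clan (X, X\<^sub>0) x))"

definition CS_connected :: "'a top_pair \<Rightarrow> bool"
  where "CS_connected = (\<lambda>(X, X\<^sub>0). connected_space X)"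

definition CS_isomorphic :: "'a top_pair \<Rightarrow> 'b top_pair \<Rightarrow> bool"
  where "CS_isomorphic = (\<lambda>(X, X\<^sub>0) (Y, Y\<^sub>0). \<exists>f. homeomorphic_map X Y f \<and> f ` X\<^sub>0 = Y\<^sub>0)"

section \<open>The canonical 2-contact space of a contact algebra\<close>

definition clan_map :: "'a contact_alg \<Rightarrow> 'a \<Rightarrow> 'a set set"
  where "clan_map B a = {\<Gamma> \<in> Clans B. a \<in> \<Gamma>}"

text \<open>The topology on \<open>S\<close> whose closed sets are the intersections of subfamilies of \<open>\<C>\<close>.
  Since \<^const>\<open>topology\<close> is unspecified on predicates that are not topologies, this needs
  the closure conditions on \<open>\<C>\<close> that are assumed in the two lemmas after the definition
  and verified for clans at the end of this section.\<close>

definition topology_with_closed_base :: "'a set \<Rightarrow> 'a set set \<Rightarrow> 'a topology"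
  where "topology_with_closed_base S \<C> = topology (\<lambda>U. \<exists>\<G>\<subseteq>\<C>. U = S - \<Inter>\<G>)"

lemma openin_topology_with_closed_base:
  assumes un: "\<And>F G. \<lbrakk>F \<in> \<C>; G \<in> \<C>\<rbrakk> \<Longrightarrow> F \<union> G \<in> \<C>"
  shows "openin (topology_with_closed_base S \<C>) U \<longleftrightarrow> (\<exists>\<G>\<subseteq>\<C>. U = S - \<Inter>\<G>)"
proof -
  have "istopology (\<lambda>U. \<exists>\<G>\<subseteq>\<C>. U = S - \<Inter>\<G>)"
    unfolding istopology_def
  proof (intro conjI allI impI)
    fix U V
    assume "\<exists>\<G>\<subseteq>\<C>. U = S - \<Inter>\<G>" "\<exists>\<G>\<subseteq>\<C>. V = S - \<Inter>\<G>"
    then obtain \<G> \<H> where *: "\<G> \<subseteq> \<C>" "U = S - \<Inter>\<G>" "\<H> \<subseteq> \<C>" "V = S - \<Inter>\<H>"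
      by auto
    have "U \<inter> V = S - \<Inter>{F \<union> G | F G. F \<in> \<G> \<and> G \<in> \<H>}"
      unfolding * by blast
    moreover have "{F \<union> G | F G. F \<in> \<G> \<and> G \<in> \<H>} \<subseteq> \<C>"
      using * un by blast
    ultimately show "\<exists>\<G>\<subseteq>\<C>. U \<inter> V = S - \<Inter>\<G>" by blast
  next
    fix \<U>
    assume "\<forall>U\<in>\<U>. \<exists>\<G>\<subseteq>\<C>. U = S - \<Inter>\<G>"
    then obtain g where g: "\<And>U. U \<in> \<U> \<Longrightarrow> g U \<subseteq> \<C> \<and> U = S - \<Inter>(g U)" by metis
    have "\<Union>\<U> = (\<Union>U\<in>\<U>. S - \<Inter>(g U))" using g by (metis (no_types, lifting) SUP_cong image_ident)
    also have "\<dots> = S - \<Inter>(\<Union>U\<in>\<U>. g U)" by blast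
    finally have "\<Union>\<U> = S - \<Inter>(\<Union>U\<in>\<U>. g U)" .
    moreover have "(\<Union>U\<in>\<U>. g U) \<subseteq> \<C>" using g by blast
    ultimately show "\<exists>\<G>\<subseteq>\<C>. \<Union>\<U> = S - \<Inter>\<G>" by blast
  qed
  then show ?thesis
    by (simp add: topology_with_closed_base_def topology_inverse')
qed

lemma closed_base_topology_with_closed_base:
  assumes sub: "\<C> \<subseteq> Pow S" and empty: "{} \<in> \<C>"
    and un: "\<And>F G. \<lbrakk>F \<in> \<C>; G \<in> \<C>\<rbrakk> \<Longrightarrow> F \<union> G \<in> \<C>"
  shows "topspace (topology_with_closed_base S \<C>) = S"
    and "closed_base (topology_with_closed_base S \<C>) \<C>"
proof -
  let ?T = "topology_with_closed_base S \<C>"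
  have op: "openin ?T U \<longleftrightarrow> (\<exists>\<G>\<subseteq>\<C>. U = S - \<Inter>\<G>)" for U
    using un by (rule openin_topology_with_closed_base)
  have "openin ?T S"
    unfolding op using empty by (intro exI[of _ "{{}}"]) auto
  moreover have "U \<subseteq> S" if "openin ?T U" for U
    using that unfolding op by blast
  ultimately show top: "topspace ?T = S"
    by (metis openin_subset openin_topspace subset_antisym)
  show "closed_base ?T \<C>"
    unfolding closed_base_def closedin_def top op
  proof (intro conjI ballI allI impI)
    fix F assume F: "F \<in> \<C>"
    then show "F \<subseteq> S" using sub by blast
    show "\<exists>\<G>\<subseteq>\<C>. S - F = S - \<Inter>\<G>"
      using F by (intro exI[of _ "{F}"]) auto
  next
    fix F assume "F \<subseteq> S \<and> (\<exists>\<G>\<subseteq>\<C>. S - F = S - \<Inter>\<G>)"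
    then obtain \<G> where "F \<subseteq> S" "\<G> \<subseteq> \<C>" "S - F = S - \<Inter>\<G>" by blast
    then have "\<G> \<subseteq> \<C>" "F = S \<inter> \<Inter>\<G>" by blast+
    then show "\<exists>\<G>\<subseteq>\<C>. F = S \<inter> \<Inter>\<G>" by blast
  qed
qed

definition clan_topology :: "'a contact_alg \<Rightarrow> 'a set topology"
  where "clan_topology B = topology_with_closed_base (Clans B) (clan_map B ` carrier B)"

definition canonical_CS :: "'a contact_alg \<Rightarrow> 'a set top_pair"
  where "canonical_CS B = (clan_topology B, Ult B)"

context contact_algebra
begin

lemma clan_map_zero: "clan_map B \<^bold>0 = {}"
  by (auto simp: clan_map_def Clans_def)

lemma clan_map_add:
  assumes a: "a \<in> carrier B" and b: "b \<in> carrier B"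
  shows "clan_map B (a \<^bold>+ b) = clan_map B a \<union> clan_map B b"
proof -
  have idem: "x \<^bold>+ x = x" if "x \<in> carrier B" for x
    by (metis that add_mult_distrib add_zero mult_compl add_compl mult_one add_closed compl_closed)
  have "ble B a (a \<^bold>+ b)"
    unfolding ble_def using a b by (metis add_assoc idem)
  moreover have "ble B b (a \<^bold>+ b)"
    unfolding ble_def using a b by (metis add_assoc add_commute idem)
  ultimately show ?thesis
    using add_closed[OF a b] a b by (auto simp: clan_map_def Clans_def)
qed

lemma topspace_clan_topology: "topspace (clan_topology B) = Clans B"
  and closed_base_clan_topology: "closed_base (clan_topology B) (clan_map B ` carrier B)"
proof -
  have 1: "clan_map B ` carrier B \<subseteq> Pow (Clans B)"
    by (auto simp: clan_map_def)
  have 2: "{} \<in> clan_map B ` carrier B"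
    using clan_map_zero zero_closed by (metis imageI)
  have 3: "F \<union> G \<in> clan_map B ` carrier B"
    if "F \<in> clan_map B ` carrier B" "G \<in> clan_map B ` carrier B" for F G
    using that clan_map_add add_closed by (smt (verit, best) image_iff)
  show "topspace (clan_topology B) = Clans B"
    "closed_base (clan_topology B) (clan_map B ` carrier B)"
    unfolding clan_topology_def using closed_base_topology_with_closed_base[OF 1 2 3] by blast+
qed

end

section \<open>Isomorphism classes\<close>

text \<open>No HOL type contains all contact algebras. The isomorphism classes below consist of the
  members on a given type, which need not be the type carrying the representative.\<close>

definition CA_class :: "'a contact_alg \<Rightarrow> 'b contact_alg set"
  where "CA_class A = {B. contact_algebra B \<and> CA_isomorphic A B}"

definition CS_class :: "'a top_pair \<Rightarrow> 'b top_pair set"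
  where "CS_class P = {Q. two_contact_space Q \<and> CS_isomorphic P Q}"

text \<open>Contact algebras on \<open>'a\<close> whose canonical 2-contact space has a copy on \<open>'b\<close>, and
  2-contact spaces on \<open>'b\<close> whose canonical contact algebra has a copy on \<open>'a\<close>.
  The first condition is void for \<open>'b = 'a set\<close>, the second one for \<open>'a = 'b set\<close>.\<close>

definition CAs_on :: "'b itself \<Rightarrow> 'a contact_alg set"
  where "CAs_on _ = {B. contact_algebra B \<and> (CS_class (canonical_CS B) :: 'b top_pair set) \<noteq> {}}"

definition CSs_on :: "'a itself \<Rightarrow> 'b top_pair set"
  where "CSs_on _ = {P. two_contact_space P \<and> (CA_class (canonical_CA P) :: 'a contact_alg set) \<noteq> {}}"

end

theory Submission
  imports Defs
begin

text \<open>For a topological pair \<open>(X,X\<^sub>0)\<close>, closure in \<open>X\<close> is an isomorphism from \<open>(CO(X\<^sub>0),\<delta>)\<close> onto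
  \<open>(RC(X,X\<^sub>0),C)\<close>, because a clopen subset of \<open>X\<^sub>0\<close> is the trace of its closure and \<open>X\<^sub>0\<close> is dense.
  For a contact algebra \<open>B\<close>, the Stone map is an isomorphism from \<open>B\<close> onto the clopen algebra of
  its canonical space: two elements are in contact iff they lie in a common clan, which can be
  taken to be a union of two ultrafilters. The closure of the Stone set of \<open>a\<close> is \<open>g\<^sub>B(a)\<close>, so
  composing the two isomorphisms gives \<open>g\<^sub>B\<close>. Conversely, a point \<open>x\<close> of a 2-contact space is
  sent to the clan of the members of \<open>RC(X,X\<^sub>0)\<close> containing \<open>x\<close>; this is injective by (CS1) and
  (CS3), surjective by (CS4), matches the closed bases, and by compactness of \<open>X\<^sub>0\<close> maps \<open>X\<^sub>0\<close>
  onto the ultrafilters.\<close>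

section \<open>Boolean algebras and their ultrafilters\<close>

text \<open>The contact axioms are verified by hand only for \<open>clopen_CA\<close>, where the
  Boolean operations are plain set operations and closure distributes over unions. The regular
  closed algebra inherits them along the closure isomorphism, so
  \<open>CA_isomorphism_contact_algebra\<close> asks nothing of its target. Connectedness transfers
  because a member of \<open>RC(X,X\<^sub>0)\<close> that is not in contact with its complement is
  clopen in \<open>X\<close>, while every clopen subset of \<open>X\<close> belongs to
  \<open>RC(X,X\<^sub>0)\<close>. The obstacle in the class correspondence is typing. The canonical
  constructions raise the type of points from \<open>'a\<close> to \<open>'a set\<close>, so an
  object and its double canonical image never share a type, and an isomorphism class on a fixed type
  may be empty. Isomorphism is therefore treated across types throughout, and the nonemptiness
  conditions in \<open>CAs_on\<close> and \<open>CSs_on\<close> keep inequivalent objects from being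
  sent to the same empty class.\<close>

context bool_alg
begin

lemma add_idem: "a \<in> carrier B \<Longrightarrow> a \<^bold>+ a = a"
  by (metis add_mult_distrib add_zero mult_compl add_compl mult_one add_closed compl_closed)

lemma mult_idem: "a \<in> carrier B \<Longrightarrow> a \<^bold>* a = a"
  by (metis add_zero add_compl compl_closed mult_add_distrib mult_closed mult_compl mult_one)

lemma add_one: "a \<in> carrier B \<Longrightarrow> a \<^bold>+ \<^bold>1 = \<^bold>1"
  by (metis compl_closed add_assoc add_compl add_idem)

lemma add_absorb: "\<lbrakk>a \<in> carrier B; b \<in> carrier B\<rbrakk> \<Longrightarrow> a \<^bold>+ (a \<^bold>* b) = a"
  by (metis add_commute add_one mult_add_distrib mult_one one_closed)

lemma mult_absorb: "\<lbrakk>a \<in> carrier B; b \<in> carrier B\<rbrakk> \<Longrightarrow> a \<^bold>* (a \<^bold>+ b) = a"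
  by (metis add_absorb mult_add_distrib mult_idem)

lemma mult_split: "\<lbrakk>a \<in> carrier B; b \<in> carrier B\<rbrakk> \<Longrightarrow> (a \<^bold>* b) \<^bold>+ (a \<^bold>* \<^bold>- b) = a"
  by (metis add_compl compl_closed mult_add_distrib mult_one)

lemma ble_refl: "a \<in> carrier B \<Longrightarrow> ble B a a"
  by (simp add: ble_def add_idem)

lemma ble_trans:
  "\<lbrakk>ble B a b; ble B b c; a \<in> carrier B; b \<in> carrier B; c \<in> carrier B\<rbrakk> \<Longrightarrow> ble B a c"
  unfolding ble_def by (metis add_assoc)

lemma ble_antisym: "\<lbrakk>ble B a b; ble B b a; a \<in> carrier B; b \<in> carrier B\<rbrakk> \<Longrightarrow> a = b"
  unfolding ble_def by (metis add_commute)

lemma ble_iff_mult: "\<lbrakk>a \<in> carrier B; b \<in> carrier B\<rbrakk> \<Longrightarrow> ble B a b \<longleftrightarrow> a \<^bold>* b = a"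
  unfolding ble_def by (metis add_absorb add_commute mult_absorb mult_commute)

lemma ble_add1: "\<lbrakk>a \<in> carrier B; b \<in> carrier B\<rbrakk> \<Longrightarrow> ble B a (a \<^bold>+ b)"
  unfolding ble_def by (metis add_assoc add_idem)

lemma ble_add2: "\<lbrakk>a \<in> carrier B; b \<in> carrier B\<rbrakk> \<Longrightarrow> ble B b (a \<^bold>+ b)"
  using ble_add1 by (metis add_commute)

lemma ble_mult1: "\<lbrakk>a \<in> carrier B; b \<in> carrier B\<rbrakk> \<Longrightarrow> ble B (a \<^bold>* b) a"
  unfolding ble_def by (metis add_absorb add_commute mult_closed)

lemma ble_mult2: "\<lbrakk>a \<in> carrier B; b \<in> carrier B\<rbrakk> \<Longrightarrow> ble B (a \<^bold>* b) b"
  using ble_mult1 by (metis mult_commute)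

lemma ble_one: "a \<in> carrier B \<Longrightarrow> ble B a \<^bold>1"
  by (simp add: ble_def add_one)

lemma ble_multI:
  "\<lbrakk>ble B c a; ble B c b; a \<in> carrier B; b \<in> carrier B; c \<in> carrier B\<rbrakk> \<Longrightarrow> ble B c (a \<^bold>* b)"
  by (metis ble_iff_mult mult_assoc mult_closed)

lemma ble_mult_mono:
  assumes "ble B a c" "ble B b d"
    and "a \<in> carrier B" "b \<in> carrier B" "c \<in> carrier B" "d \<in> carrier B"
  shows "ble B (a \<^bold>* b) (c \<^bold>* d)"
  using assms by (meson ble_mult1 ble_mult2 ble_multI ble_trans mult_closed)

lemma ble_if_mult_compl:
  assumes "a \<^bold>* \<^bold>- b = \<^bold>0" and ab: "a \<in> carrier B" "b \<in> carrier B"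
  shows "ble B a b"
  using assms mult_split[OF ab] by (metis add_zero ble_iff_mult mult_closed)

lemma filter_one: "proper_filter B F \<Longrightarrow> \<^bold>1 \<in> F"
  unfolding proper_filter_def by (metis ble_one equals0I one_closed subsetD)

lemma filter_mult_iff:
  assumes "proper_filter B F" "a \<in> carrier B" "b \<in> carrier B"
  shows "a \<^bold>* b \<in> F \<longleftrightarrow> a \<in> F \<and> b \<in> F"
  using assms unfolding proper_filter_def by (metis ble_mult1 ble_mult2)

lemma principal_filter:
  assumes "a \<in> carrier B" "a \<noteq> \<^bold>0"
  shows "proper_filter B {x \<in> carrier B. ble B a x}"
  unfolding proper_filter_def
proof (intro conjI ballI impI)
  show "{x \<in> carrier B. ble B a x} \<noteq> {}" using assms ble_refl by blast
  show "\<^bold>0 \<notin> {x \<in> carrier B. ble B a x}" using assms by (simp add: add_zero ble_def)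
  fix x assume x: "x \<in> {x \<in> carrier B. ble B a x}"
  show "y \<in> {x \<in> carrier B. ble B a x}" if "y \<in> carrier B" "ble B x y" for y
    using x that assms(1) ble_trans by blast
  show "x \<^bold>* y \<in> {x \<in> carrier B. ble B a x}" if "y \<in> {x \<in> carrier B. ble B a x}" for y
    using x that assms(1) by (simp add: mult_closed ble_multI)
qed blast

text \<open>The sets \<open>G\<close> below are the grills; the complement of a grill is an ideal, so this is
  the Boolean prime ideal theorem for a filter disjoint from an ideal.\<close>

lemma filter_extends_in_grill:
  assumes F: "proper_filter B F" "F \<subseteq> G"
    and G: "G \<subseteq> carrier B" "\<^bold>0 \<notin> G"
    and up: "\<And>a b. \<lbrakk>a \<in> G; b \<in> carrier B; ble B a b\<rbrakk> \<Longrightarrow> b \<in> G"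
    and prime: "\<And>a b. \<lbrakk>a \<in> carrier B; b \<in> carrier B; a \<^bold>+ b \<in> G\<rbrakk> \<Longrightarrow> a \<in> G \<or> b \<in> G"
  obtains U where "proper_filter B U" "F \<subseteq> U" "U \<subseteq> G" "\<And>b. b \<in> carrier B \<Longrightarrow> b \<in> U \<or> \<^bold>- b \<in> U"
proof -
  let ?A = "{U. proper_filter B U \<and> F \<subseteq> U \<and> U \<subseteq> G}"
  have "\<exists>M\<in>?A. \<forall>X\<in>?A. M \<subseteq> X \<longrightarrow> X = M"
  proof (rule subset_Zorn_nonempty)
    show "?A \<noteq> {}" using F by blast
    fix \<C> assume ne: "\<C> \<noteq> {}" and "subset.chain ?A \<C>"
    then have sub: "\<C> \<subseteq> ?A" and ch: "\<And>U V. \<lbrakk>U \<in> \<C>; V \<in> \<C>\<rbrakk> \<Longrightarrow> U \<subseteq> V \<or> V \<subseteq> U"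
      by (auto simp: subset_chain_def)
    have "a \<^bold>* b \<in> \<Union>\<C>" if ab: "a \<in> \<Union>\<C>" "b \<in> \<Union>\<C>" for a b
    proof -
      obtain U V where UV: "U \<in> \<C>" "a \<in> U" "V \<in> \<C>" "b \<in> V" using ab by blast
      with ch[of U V] have "\<exists>W\<in>\<C>. a \<in> W \<and> b \<in> W" by blast
      then show ?thesis using sub unfolding proper_filter_def by blast
    qed
    moreover have *: "F \<subseteq> \<Union>\<C>" "\<Union>\<C> \<subseteq> G" using sub ne by auto
    moreover have "b \<in> \<Union>\<C>" if "a \<in> \<Union>\<C>" "b \<in> carrier B" "ble B a b" for a b
      using that sub unfolding proper_filter_def by blast
    moreover have "F \<noteq> {}" using F(1) by (simp add: proper_filter_def)
    then have "\<Union>\<C> \<noteq> {}" using *(1) by blast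
    moreover have "\<Union>\<C> \<subseteq> carrier B" "\<^bold>0 \<notin> \<Union>\<C>" using * G by blast+
    ultimately have "proper_filter B (\<Union>\<C>)"
      unfolding proper_filter_def by (intro conjI ballI impI)
    with * show "\<Union>\<C> \<in> ?A" by simp
  qed
  then obtain U where U: "proper_filter B U" "F \<subseteq> U" "U \<subseteq> G"
    and max: "\<And>X. \<lbrakk>proper_filter B X; U \<subseteq> X; X \<subseteq> G\<rbrakk> \<Longrightarrow> X = U"
    by auto
  have Uc: "U \<subseteq> carrier B" and U_mult: "\<And>x y. \<lbrakk>x \<in> U; y \<in> U\<rbrakk> \<Longrightarrow> x \<^bold>* y \<in> U"
    using U(1) unfolding proper_filter_def by blast+
  \<comment> \<open>\<open>?X\<close> is the filter generated by \<open>U\<close> and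
    \<open>b\<close>. It stays inside the grill exactly when all products \<open>x * b\<close> do,
    and then maximality of \<open>U\<close> forces \<open>b\<close> into \<open>U\<close>.\<close>
  have step: "b \<in> U" if b: "b \<in> carrier B" and all: "\<And>x. x \<in> U \<Longrightarrow> x \<^bold>* b \<in> G" for b
  proof -
    let ?X = "{y \<in> carrier B. \<exists>x\<in>U. ble B (x \<^bold>* b) y}"
    have XG: "?X \<subseteq> G" using all up by blast
    have one: "\<^bold>1 \<in> U" using U(1) by (rule filter_one)
    have UX: "U \<subseteq> ?X" using Uc b ble_mult1 by blast
    have bX: "b \<in> ?X" using one b ble_mult2[OF one_closed b] by blast
    have "proper_filter B ?X"
      unfolding proper_filter_def
    proof (intro conjI ballI impI)
      show "?X \<noteq> {}" using bX by blast
      show "\<^bold>0 \<notin> ?X" using XG G(2) by blast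
      fix y assume y: "y \<in> ?X"
      then obtain x where x: "x \<in> U" "ble B (x \<^bold>* b) y" by blast
      show "z \<in> ?X" if "z \<in> carrier B" "ble B y z" for z
        using x y that Uc b ble_trans mult_closed by blast
      show "y \<^bold>* z \<in> ?X" if z: "z \<in> ?X" for z
      proof -
        obtain x' where x': "x' \<in> U" "ble B (x' \<^bold>* b) z" using z by blast
        have c: "x \<in> carrier B" "x' \<in> carrier B" "y \<in> carrier B" "z \<in> carrier B"
          using x x' y z Uc by blast+
        have "(x \<^bold>* x') \<^bold>* b = (x \<^bold>* b) \<^bold>* (x' \<^bold>* b)"
          using c b by (metis mult_assoc mult_commute mult_idem mult_closed)
        then have "ble B ((x \<^bold>* x') \<^bold>* b) (y \<^bold>* z)"
          using ble_mult_mono[OF x(2) x'(2)] c b mult_closed by simp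
        then show ?thesis using U_mult[OF x(1) x'(1)] c mult_closed by blast
      qed
    qed blast
    then show ?thesis using max UX XG bX by blast
  qed
  have "b \<in> U \<or> \<^bold>- b \<in> U" if b: "b \<in> carrier B" for b
  proof (rule ccontr)
    assume "\<not> ?thesis"
    then obtain x y where xy: "x \<in> U" "x \<^bold>* b \<notin> G" "y \<in> U" "y \<^bold>* \<^bold>- b \<notin> G"
      using step b compl_closed by blast
    have c: "x \<in> carrier B" "y \<in> carrier B" using xy Uc by blast+
    \<comment> \<open>The product lies below both witnesses and in \<open>U\<close>, hence in
      \<open>G\<close>. Splitting it along \<open>b\<close> and using primality of \<open>G\<close>
      puts one part into \<open>G\<close>, and upward closure then contradicts the choice of
      \<open>x\<close> or \<open>y\<close>.\<close>
    let ?z = "x \<^bold>* y"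
    have z: "?z \<in> carrier B" using c mult_closed by blast
    have "?z \<^bold>* b \<in> G \<or> ?z \<^bold>* \<^bold>- b \<in> G"
      using U_mult[OF xy(1,3)] U(3) prime[of "?z \<^bold>* b" "?z \<^bold>* \<^bold>- b"] mult_split[OF z b]
        mult_closed z b compl_closed by auto
    moreover have "ble B (?z \<^bold>* b) (x \<^bold>* b)" "ble B (?z \<^bold>* \<^bold>- b) (y \<^bold>* \<^bold>- b)"
      using c b z by (simp_all add: ble_mult1 ble_mult2 ble_mult_mono ble_refl compl_closed)
    ultimately show False
      using xy up c b by (meson compl_closed mult_closed)
  qed
  with U that show thesis by blast
qed

text \<open>The nonzero elements form the largest grill, and it contains every proper filter; with
  this choice the grill version becomes ordinary ultrafilter extension.\<close>

lemma filter_extends: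
  assumes F: "proper_filter B F"
  obtains U where "proper_filter B U" "F \<subseteq> U" "\<And>b. b \<in> carrier B \<Longrightarrow> b \<in> U \<or> \<^bold>- b \<in> U"
proof (rule filter_extends_in_grill[OF F, of "carrier B - {\<^bold>0}"])
  show "F \<subseteq> carrier B - {\<^bold>0}" using F by (auto simp: proper_filter_def)
  show "b \<in> carrier B - {\<^bold>0}"
    if "a \<in> carrier B - {\<^bold>0}" "b \<in> carrier B" "ble B a b" for a b
    using that by (auto simp: ble_def add_zero)
  show "a \<in> carrier B - {\<^bold>0} \<or> b \<in> carrier B - {\<^bold>0}"
    if "a \<in> carrier B" "b \<in> carrier B" "a \<^bold>+ b \<in> carrier B - {\<^bold>0}" for a b
    using that add_zero zero_closed by auto
qed (use that in auto)

text \<open>A maximal filter equals its two-valued extension. Conversely, an element of a larger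
  proper filter cannot have its complement in \<open>U\<close>, so it already lies in
  \<open>U\<close>. All later work uses this form instead of maximality.\<close>

lemma Ult_iff:
  "U \<in> Ult B \<longleftrightarrow> proper_filter B U \<and> (\<forall>b\<in>carrier B. b \<in> U \<or> \<^bold>- b \<in> U)"
proof (intro iffI conjI)
  assume U: "U \<in> Ult B"
  then show pf: "proper_filter B U" by (simp add: Ult_def)
  obtain V where "proper_filter B V" "U \<subseteq> V" "\<And>b. b \<in> carrier B \<Longrightarrow> b \<in> V \<or> \<^bold>- b \<in> V"
    using filter_extends[OF pf] by blast
  then show "\<forall>b\<in>carrier B. b \<in> U \<or> \<^bold>- b \<in> U"
    using U by (auto simp: Ult_def)
next
  assume U: "proper_filter B U \<and> (\<forall>b\<in>carrier B. b \<in> U \<or> \<^bold>- b \<in> U)"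
  have "F = U" if F: "proper_filter B F" "U \<subseteq> F" for F
  proof
    show "F \<subseteq> U"
    proof
      fix x assume x: "x \<in> F"
      then have xc: "x \<in> carrier B" using F by (auto simp: proper_filter_def)
      have "\<^bold>- x \<notin> F"
        using x F(1) mult_compl[OF xc] unfolding proper_filter_def by metis
      then show "x \<in> U" using U F(2) xc by blast
    qed
  qed (rule F(2))
  with U show "U \<in> Ult B" by (auto simp: Ult_def)
qed

lemma
  assumes U: "U \<in> Ult B"
  shows Ult_subset: "U \<subseteq> carrier B"
    and Ult_zero: "\<^bold>0 \<notin> U"
    and Ult_one: "\<^bold>1 \<in> U"
    and Ult_up: "\<lbrakk>a \<in> U; ble B a b; b \<in> carrier B\<rbrakk> \<Longrightarrow> b \<in> U"
    and Ult_mult: "\<lbrakk>a \<in> carrier B; b \<in> carrier B\<rbrakk> \<Longrightarrow> a \<^bold>* b \<in> U \<longleftrightarrow> a \<in> U \<and> b \<in> U"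
    and Ult_compl: "a \<in> carrier B \<Longrightarrow> \<^bold>- a \<in> U \<longleftrightarrow> a \<notin> U"
    and Ult_add: "\<lbrakk>a \<in> carrier B; b \<in> carrier B\<rbrakk> \<Longrightarrow> a \<^bold>+ b \<in> U \<longleftrightarrow> a \<in> U \<or> b \<in> U"
proof -
  have pf: "proper_filter B U" and or: "\<And>b. b \<in> carrier B \<Longrightarrow> b \<in> U \<or> \<^bold>- b \<in> U"
    using U Ult_iff by blast+
  show sub: "U \<subseteq> carrier B" and z: "\<^bold>0 \<notin> U" using pf by (auto simp: proper_filter_def)
  show "\<^bold>1 \<in> U" using pf by (rule filter_one)
  show up: "b \<in> U" if "a \<in> U" "ble B a b" "b \<in> carrier B" for a b
    using pf that by (auto simp: proper_filter_def)
  show m: "a \<^bold>* b \<in> U \<longleftrightarrow> a \<in> U \<and> b \<in> U" if "a \<in> carrier B" "b \<in> carrier B" for a b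
    using filter_mult_iff[OF pf that] .
  show c: "\<^bold>- a \<in> U \<longleftrightarrow> a \<notin> U" if "a \<in> carrier B" for a
    using m[OF that compl_closed[OF that]] or[OF that] z mult_compl[OF that] by metis
  show "a \<^bold>+ b \<in> U \<longleftrightarrow> a \<in> U \<or> b \<in> U" if ab: "a \<in> carrier B" "b \<in> carrier B"
  proof
    assume s: "a \<^bold>+ b \<in> U"
    show "a \<in> U \<or> b \<in> U"
    proof (rule ccontr)
      assume "\<not> ?thesis"
      then have "\<^bold>- a \<^bold>* (a \<^bold>+ b) \<in> U" "\<^bold>- b \<in> U"
        using c m s ab add_closed compl_closed by metis+
      moreover have "\<^bold>- a \<^bold>* (a \<^bold>+ b) = \<^bold>- a \<^bold>* b"
        using ab by (metis add_commute add_zero compl_closed mult_add_distrib mult_closed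
            mult_commute mult_compl zero_closed)
      ultimately show False using m c ab compl_closed by metis
    qed
  qed (use up ab ble_add1 ble_add2 add_closed in metis)
qed

text \<open>If a is not below b, then a * -b is nonzero, and an ultrafilter extending its principal
  filter contains a but omits b. This makes the Stone map an order embedding.\<close>

lemma Ult_ble_iff:
  assumes "a \<in> carrier B" "b \<in> carrier B"
  shows "ble B a b \<longleftrightarrow> (\<forall>U\<in>Ult B. a \<in> U \<longrightarrow> b \<in> U)"
proof
  assume r: "\<forall>U\<in>Ult B. a \<in> U \<longrightarrow> b \<in> U"
  have "a \<^bold>* \<^bold>- b = \<^bold>0"
  proof (rule ccontr)
    assume nz: "a \<^bold>* \<^bold>- b \<noteq> \<^bold>0"
    have c: "a \<^bold>* \<^bold>- b \<in> carrier B" using assms by (simp add: mult_closed compl_closed)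
    have pf: "proper_filter B {x \<in> carrier B. ble B (a \<^bold>* \<^bold>- b) x}"
      using principal_filter[OF c nz] .
    obtain U where "proper_filter B U" "{x \<in> carrier B. ble B (a \<^bold>* \<^bold>- b) x} \<subseteq> U"
      "\<And>b. b \<in> carrier B \<Longrightarrow> b \<in> U \<or> \<^bold>- b \<in> U"
      using filter_extends[OF pf] by blast
    then have U: "U \<in> Ult B" and "a \<^bold>* \<^bold>- b \<in> U" using Ult_iff c ble_refl by auto
    then have "a \<in> U" "b \<notin> U"
      using Ult_mult[OF U] Ult_compl[OF U] assms compl_closed by simp_all
    then show False using r U by blast
  qed
  then show "ble B a b" using assms by (rule ble_if_mult_compl)
qed (auto intro: Ult_up assms)

end

section \<open>Contact algebras and clans\<close>

context contact_algebra
begin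

lemma contact_mono:
  assumes "contact B a b" "ble B a a'" "ble B b b'"
    and "a \<in> carrier B" "b \<in> carrier B" "a' \<in> carrier B" "b' \<in> carrier B"
  shows "contact B a' b'"
  using assms contact_add_left[of a a' b] contact_add_right[of a' b b']
  unfolding ble_def by simp

lemma ClansI:
  assumes "\<Gamma> \<subseteq> carrier B" "\<Gamma> \<noteq> {}" "\<^bold>0 \<notin> \<Gamma>"
    and "\<And>a b. \<lbrakk>a \<in> \<Gamma>; b \<in> carrier B; ble B a b\<rbrakk> \<Longrightarrow> b \<in> \<Gamma>"
    and "\<And>a b. \<lbrakk>a \<in> carrier B; b \<in> carrier B; a \<^bold>+ b \<in> \<Gamma>\<rbrakk> \<Longrightarrow> a \<in> \<Gamma> \<or> b \<in> \<Gamma>"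
    and "\<And>a b. \<lbrakk>a \<in> \<Gamma>; b \<in> \<Gamma>\<rbrakk> \<Longrightarrow> contact B a b"
  shows "\<Gamma> \<in> Clans B"
  using assms by (simp add: Clans_def)

text \<open>The product of two members of an ultrafilter is nonzero, hence in contact with itself,
  and contact passes to larger elements.\<close>

lemma Ult_subset_Clans: "Ult B \<subseteq> Clans B"
proof
  fix U assume U: "U \<in> Ult B"
  have "contact B a b" if "a \<in> U" "b \<in> U" for a b
  proof -
    have c: "a \<in> carrier B" "b \<in> carrier B" using Ult_subset[OF U] that by auto
    have "a \<^bold>* b \<in> U" using Ult_mult[OF U c] that by simp
    then have "a \<^bold>* b \<noteq> \<^bold>0" using Ult_zero[OF U] by auto
    then have "contact B (a \<^bold>* b) (a \<^bold>* b)" using contact_refl c mult_closed by blast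
    then show ?thesis 
      using contact_mono[OF _ ble_mult1[OF c] ble_mult2[OF c]] c mult_closed[OF c] by simp
  qed
  moreover have "U \<noteq> {}" using Ult_one[OF U] by auto
  ultimately show "U \<in> Clans B"
    by (intro ClansI) (use Ult_subset[OF U] Ult_zero[OF U] Ult_add[OF U] in \<open>simp_all add: Ult_up[OF U]\<close>)
qed

lemma
  assumes G: "\<Gamma> \<in> Clans B"
  shows Clan_subset: "\<Gamma> \<subseteq> carrier B"
    and Clan_zero: "\<^bold>0 \<notin> \<Gamma>"
    and Clan_up: "\<lbrakk>a \<in> \<Gamma>; ble B a b; b \<in> carrier B\<rbrakk> \<Longrightarrow> b \<in> \<Gamma>"
    and Clan_add: "\<lbrakk>a \<in> carrier B; b \<in> carrier B\<rbrakk> \<Longrightarrow> a \<^bold>+ b \<in> \<Gamma> \<longleftrightarrow> a \<in> \<Gamma> \<or> b \<in> \<Gamma>"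
    and Clan_contact: "\<lbrakk>a \<in> \<Gamma>; b \<in> \<Gamma>\<rbrakk> \<Longrightarrow> contact B a b"
    and Clan_one: "\<^bold>1 \<in> \<Gamma>"
proof -
  show sub: "\<Gamma> \<subseteq> carrier B" and "\<^bold>0 \<notin> \<Gamma>"
    using G by (simp_all add: Clans_def)
  show up: "b \<in> \<Gamma>" if "a \<in> \<Gamma>" "ble B a b" "b \<in> carrier B" for a b
    using G that by (simp add: Clans_def)
  show "a \<^bold>+ b \<in> \<Gamma> \<longleftrightarrow> a \<in> \<Gamma> \<or> b \<in> \<Gamma>" if "a \<in> carrier B" "b \<in> carrier B"
    using G up[OF _ ble_add1[OF that]] up[OF _ ble_add2[OF that]] add_closed[OF that] that
    by (auto simp add: Clans_def)
  show "contact B a b" if "a \<in> \<Gamma>" "b \<in> \<Gamma>"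
    using G that by (simp add: Clans_def)
  obtain a where "a \<in> \<Gamma>" using G by (auto simp: Clans_def)
  then show "\<^bold>1 \<in> \<Gamma>" using up[of a] ble_one one_closed sub by blast
qed

text \<open>Upward closure places the principal filter of \<open>a\<close> inside the grill, where
  it can be extended.\<close>

lemma Ult_in_grill:
  assumes a: "a \<in> G" and G: "G \<subseteq> carrier B" "\<^bold>0 \<notin> G"
    and up: "\<And>a b. \<lbrakk>a \<in> G; b \<in> carrier B; ble B a b\<rbrakk> \<Longrightarrow> b \<in> G"
    and prime: "\<And>a b. \<lbrakk>a \<in> carrier B; b \<in> carrier B; a \<^bold>+ b \<in> G\<rbrakk> \<Longrightarrow> a \<in> G \<or> b \<in> G"
  obtains U where "U \<in> Ult B" "a \<in> U" "U \<subseteq> G"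
proof -
  let ?F = "{x \<in> carrier B. ble B a x}"
  have ac: "a \<in> carrier B" and a0: "a \<noteq> \<^bold>0" using a G by auto
  have F: "proper_filter B ?F" using ac a0 by (rule principal_filter)
  have FG: "?F \<subseteq> G" using up a by blast
  show thesis
  proof (rule filter_extends_in_grill[OF F FG G])
    fix U assume U: "proper_filter B U" "?F \<subseteq> U" "U \<subseteq> G"
      "\<And>b. b \<in> carrier B \<Longrightarrow> b \<in> U \<or> \<^bold>- b \<in> U"
    show thesis
    proof (rule that)
      show "U \<in> Ult B" using U(1,4) by (simp add: Ult_iff)
      show "a \<in> U" using U(2) ac ble_refl by blast
    qed (rule U(3))
  qed (fact up, fact prime)
qed

text \<open>Two ultrafilters that are pairwise in contact have a clan as their union; they are found
  one after the other inside the grills of the elements in contact with everything chosen so far.\<close>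

lemma contact_iff_Clan:
  assumes a: "a \<in> carrier B" and b: "b \<in> carrier B"
  shows "contact B a b \<longleftrightarrow> (\<exists>\<Gamma>\<in>Clans B. a \<in> \<Gamma> \<and> b \<in> \<Gamma>)"
proof
  assume ab: "contact B a b"
  let ?G = "{x \<in> carrier B. contact B x b}"
  obtain U where U: "U \<in> Ult B" "a \<in> U" "U \<subseteq> ?G"
  proof (rule Ult_in_grill[of a ?G])
    show "a \<in> ?G" using a ab by simp
    show "\<^bold>0 \<notin> ?G" using contact_nonzero[of "\<^bold>0" b] b by auto
    show "y \<in> ?G" if "x \<in> ?G" "y \<in> carrier B" "ble B x y" for x y
      using that b contact_mono[of x b y b] ble_refl[OF b] by simp
    show "x \<in> ?G \<or> y \<in> ?G" if "x \<in> carrier B" "y \<in> carrier B" "x \<^bold>+ y \<in> ?G" for x y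
      using that b contact_add_left[of x y b] by simp
  qed auto
  have Uc: "U \<subseteq> carrier B" using Ult_subset[OF U(1)] .
  let ?H = "{y \<in> carrier B. \<forall>x\<in>U. contact B x y}"
  obtain V where V: "V \<in> Ult B" "b \<in> V" "V \<subseteq> ?H"
  proof (rule Ult_in_grill[of b ?H])
    show "b \<in> ?H" using b U(3) by auto
    show "\<^bold>0 \<notin> ?H" using contact_nonzero[of a "\<^bold>0"] a U(2) by auto
    show "y \<in> ?H" if xy: "x \<in> ?H" "y \<in> carrier B" "ble B x y" for x y
    proof -
      have "contact B u y" if "u \<in> U" for u
        using that xy contact_mono[of u x u y] ble_refl[of u] Uc by auto
      then show ?thesis using xy by simp
    qed
    \<comment> \<open>This is where \<open>U\<close> has to be a filter: the two elements of
      \<open>U\<close> witnessing failure for \<open>y\<close> and for \<open>z\<close> are replaced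
      by their product, which is in contact with \<open>y\<close> + \<open>z\<close> and hence with
      one summand.\<close>
    show "y \<in> ?H \<or> z \<in> ?H" if yz: "y \<in> carrier B" "z \<in> carrier B" "y \<^bold>+ z \<in> ?H" for y z
    proof (rule ccontr)
      assume "\<not> ?thesis"
      then obtain x x' where x: "x \<in> U" "\<not> contact B x y" "x' \<in> U" "\<not> contact B x' z"
        using yz by blast
      then have c: "x \<in> carrier B" "x' \<in> carrier B" using Uc by auto
      have xc: "x \<^bold>* x' \<in> carrier B" using c mult_closed by blast
      have "x \<^bold>* x' \<in> U" using Ult_mult[OF U(1) c] x by simp
      then have "contact B (x \<^bold>* x') y \<or> contact B (x \<^bold>* x') z"
        using yz contact_add_right[of "x \<^bold>* x'" y z] xc by simp
      then show False
        using x yz c xc contact_mono[of "x \<^bold>* x'" y x y] contact_mono[of "x \<^bold>* x'" z x' z]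
          ble_mult1[OF c] ble_mult2[OF c] ble_refl[of y] ble_refl[of z] by auto
    qed
  qed auto
  have Vc: "V \<subseteq> carrier B" using Ult_subset[OF V(1)] .
  have C: "U \<in> Clans B" "V \<in> Clans B" using U V Ult_subset_Clans by auto
  have "U \<union> V \<in> Clans B"
  proof (rule ClansI)
    \<comment> \<open>Mixed pairs are in contact since \<open>V\<close> was chosen inside
      \<open>?H\<close>, up to symmetry; pairs inside \<open>U\<close> or inside \<open>V\<close>
      are in contact since both are clans.\<close>
    show "contact B x y" if "x \<in> U \<union> V" "y \<in> U \<union> V" for x y
    proof -
      have "contact B x y" if "x \<in> U" "y \<in> V" for x y using that V(3) by auto
      moreover from this have "contact B y x" if "x \<in> U" "y \<in> V" for x y
        using that contact_sym[of x y] Uc Vc by auto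
      ultimately show ?thesis using that Clan_contact[OF C(1)] Clan_contact[OF C(2)] by auto
    qed
    show "y \<in> U \<union> V" if "x \<in> U \<union> V" "y \<in> carrier B" "ble B x y" for x y
      using that Clan_up[OF C(1), of x y] Clan_up[OF C(2), of x y] by auto
    show "x \<in> U \<union> V \<or> y \<in> U \<union> V" if "x \<in> carrier B" "y \<in> carrier B" "x \<^bold>+ y \<in> U \<union> V" for x y
      using that Clan_add[OF C(1), of x y] Clan_add[OF C(2), of x y] by auto
  qed (use U(2) Uc Vc Clan_zero[OF C(1)] Clan_zero[OF C(2)] in auto)
  then show "\<exists>\<Gamma>\<in>Clans B. a \<in> \<Gamma> \<and> b \<in> \<Gamma>" using U V by blast
qed (use Clan_contact in blast)

end

section \<open>Isomorphisms of contact algebras\<close>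

lemma CA_isomorphismI:
  assumes "bij_betw \<phi> (carrier A) (carrier B)"
    and "\<phi> \<^bold>0\<^bsub>A\<^esub> = \<^bold>0\<^bsub>B\<^esub>" "\<phi> \<^bold>1\<^bsub>A\<^esub> = \<^bold>1\<^bsub>B\<^esub>"
    and "\<And>a b. \<lbrakk>a \<in> carrier A; b \<in> carrier A\<rbrakk> \<Longrightarrow> \<phi> (a \<^bold>+\<^bsub>A\<^esub> b) = \<phi> a \<^bold>+\<^bsub>B\<^esub> \<phi> b"
    and "\<And>a b. \<lbrakk>a \<in> carrier A; b \<in> carrier A\<rbrakk> \<Longrightarrow> \<phi> (a \<^bold>*\<^bsub>A\<^esub> b) = \<phi> a \<^bold>*\<^bsub>B\<^esub> \<phi> b"
    and "\<And>a. a \<in> carrier A \<Longrightarrow> \<phi> (\<^bold>-\<^bsub>A\<^esub> a) = \<^bold>-\<^bsub>B\<^esub> \<phi> a"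
    and "\<And>a b. \<lbrakk>a \<in> carrier A; b \<in> carrier A\<rbrakk> \<Longrightarrow> contact A a b \<longleftrightarrow> contact B (\<phi> a) (\<phi> b)"
  shows "CA_isomorphism \<phi> A B"
  using assms by (simp add: CA_isomorphism_def)

lemma
  assumes "CA_isomorphism \<phi> A B"
  shows iso_bij: "bij_betw \<phi> (carrier A) (carrier B)"
    and iso_closed: "a \<in> carrier A \<Longrightarrow> \<phi> a \<in> carrier B"
    and iso_inj: "\<lbrakk>a \<in> carrier A; b \<in> carrier A\<rbrakk> \<Longrightarrow> \<phi> a = \<phi> b \<longleftrightarrow> a = b"
    and iso_image: "\<phi> ` carrier A = carrier B"
    and iso_zero: "\<phi> \<^bold>0\<^bsub>A\<^esub> = \<^bold>0\<^bsub>B\<^esub>"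
    and iso_one: "\<phi> \<^bold>1\<^bsub>A\<^esub> = \<^bold>1\<^bsub>B\<^esub>"
    and iso_add: "\<lbrakk>a \<in> carrier A; b \<in> carrier A\<rbrakk> \<Longrightarrow> \<phi> (a \<^bold>+\<^bsub>A\<^esub> b) = \<phi> a \<^bold>+\<^bsub>B\<^esub> \<phi> b"
    and iso_mult: "\<lbrakk>a \<in> carrier A; b \<in> carrier A\<rbrakk> \<Longrightarrow> \<phi> (a \<^bold>*\<^bsub>A\<^esub> b) = \<phi> a \<^bold>*\<^bsub>B\<^esub> \<phi> b"
    and iso_compl: "a \<in> carrier A \<Longrightarrow> \<phi> (\<^bold>-\<^bsub>A\<^esub> a) = \<^bold>-\<^bsub>B\<^esub> \<phi> a"
    and iso_contact: "\<lbrakk>a \<in> carrier A; b \<in> carrier A\<rbrakk> \<Longrightarrow> contact A a b \<longleftrightarrow> contact B (\<phi> a) (\<phi> b)"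
proof -
  show "\<phi> a \<in> carrier B" if "a \<in> carrier A"
    using assms that by (auto simp: CA_isomorphism_def bij_betw_def)
  show "\<phi> a = \<phi> b \<longleftrightarrow> a = b" if "a \<in> carrier A" "b \<in> carrier A"
    using assms that by (auto simp: CA_isomorphism_def bij_betw_def inj_on_def)
  show "\<phi> ` carrier A = carrier B"
    using assms by (auto simp: CA_isomorphism_def bij_betw_def)
qed (use assms in \<open>simp_all add: CA_isomorphism_def\<close>)

lemma CA_isomorphism_inv:
  assumes A: "contact_algebra A" and iso: "CA_isomorphism \<phi> A B"
  shows "CA_isomorphism (inv_into (carrier A) \<phi>) B A"
proof -
  interpret A: contact_algebra A by (rule A)
  let ?\<psi> = "inv_into (carrier A) \<phi>"
  have im: "carrier B = \<phi> ` carrier A" using iso_image[OF iso] by simp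
  have l: "?\<psi> (\<phi> a) = a" if "a \<in> carrier A" for a
    using that iso_bij[OF iso] by (simp add: bij_betw_def inv_into_f_f)
  show ?thesis
  proof (rule CA_isomorphismI)
    show "bij_betw ?\<psi> (carrier B) (carrier A)"
      using iso_bij[OF iso] by (rule bij_betw_inv_into)
    show "?\<psi> \<^bold>0\<^bsub>B\<^esub> = \<^bold>0\<^bsub>A\<^esub>" "?\<psi> \<^bold>1\<^bsub>B\<^esub> = \<^bold>1\<^bsub>A\<^esub>"
      using l A.zero_closed A.one_closed iso_zero[OF iso] iso_one[OF iso] by metis+
    show "?\<psi> (\<^bold>-\<^bsub>B\<^esub> b) = \<^bold>-\<^bsub>A\<^esub> ?\<psi> b" if "b \<in> carrier B" for b
      using that unfolding im
      by (auto simp: l A.compl_closed simp flip: iso_compl[OF iso])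
    fix b c assume bc: "b \<in> carrier B" "c \<in> carrier B"
    show "?\<psi> (b \<^bold>+\<^bsub>B\<^esub> c) = ?\<psi> b \<^bold>+\<^bsub>A\<^esub> ?\<psi> c"
      using bc unfolding im by (auto simp: l A.add_closed simp flip: iso_add[OF iso])
    show "?\<psi> (b \<^bold>*\<^bsub>B\<^esub> c) = ?\<psi> b \<^bold>*\<^bsub>A\<^esub> ?\<psi> c"
      using bc unfolding im by (auto simp: l A.mult_closed simp flip: iso_mult[OF iso])
    show "contact B b c \<longleftrightarrow> contact A (?\<psi> b) (?\<psi> c)"
      using bc unfolding im by (auto simp: l iso_contact[OF iso])
  qed
qed

lemma CA_isomorphism_comp:
  assumes \<phi>: "CA_isomorphism \<phi> A B" and \<psi>: "CA_isomorphism \<psi> B C"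
  shows "CA_isomorphism (\<psi> \<circ> \<phi>) A C"
  by (rule CA_isomorphismI)
    (simp_all add: iso_closed[OF \<phi>] iso_zero[OF \<phi>] iso_one[OF \<phi>] iso_add[OF \<phi>] iso_mult[OF \<phi>]
      iso_compl[OF \<phi>] iso_contact[OF \<phi>] iso_zero[OF \<psi>] iso_one[OF \<psi>] iso_add[OF \<psi>]
      iso_mult[OF \<psi>] iso_compl[OF \<psi>] iso_contact[OF \<psi>]
      bij_betw_trans[OF iso_bij[OF \<phi>] iso_bij[OF \<psi>]])

lemma CA_isomorphic_sym: "\<lbrakk>contact_algebra A; CA_isomorphic A B\<rbrakk> \<Longrightarrow> CA_isomorphic B A"
  using CA_isomorphism_inv unfolding CA_isomorphic_def by blast

lemma CA_isomorphic_trans: "\<lbrakk>CA_isomorphic A B; CA_isomorphic B C\<rbrakk> \<Longrightarrow> CA_isomorphic A C"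
  using CA_isomorphism_comp unfolding CA_isomorphic_def by blast

text \<open>Every element of the target is an image and \<phi> respects all operations, so each
  axiom pulls back to the source. This supplies the axioms for \<open>canonical_CA\<close> without
  computing with regular closed sets.\<close>

lemma CA_isomorphism_contact_algebra:
  assumes A: "contact_algebra A" and iso: "CA_isomorphism \<phi> A B"
  shows "contact_algebra B"
proof -
  interpret A: contact_algebra A by (rule A)
  have im: "carrier B = \<phi> ` carrier A" using iso_image[OF iso] by simp
  \<comment> \<open>Read from right to left, the homomorphism laws turn every expression over images
    into the image of one expression in \<open>A\<close>; injectivity then removes \<phi>.\<close>
  note to_A = iso_zero[OF iso, symmetric] iso_one[OF iso, symmetric] iso_add[OF iso, symmetric]
    iso_mult[OF iso, symmetric] iso_compl[OF iso, symmetric] iso_contact[OF iso, symmetric]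
    iso_inj[OF iso]
  note closed = A.zero_closed A.one_closed A.add_closed A.mult_closed A.compl_closed
  show ?thesis
  proof (unfold_locales, unfold im)
    show "\<^bold>0\<^bsub>B\<^esub> \<in> \<phi> ` carrier A" "\<^bold>1\<^bsub>B\<^esub> \<in> \<phi> ` carrier A"
      by (simp_all add: to_A closed)
    fix a assume "a \<in> \<phi> ` carrier A"
    then show "\<^bold>-\<^bsub>B\<^esub> a \<in> \<phi> ` carrier A" "a \<^bold>*\<^bsub>B\<^esub> \<^bold>1\<^bsub>B\<^esub> = a" "a \<^bold>+\<^bsub>B\<^esub> \<^bold>0\<^bsub>B\<^esub> = a"
      "a \<^bold>*\<^bsub>B\<^esub> \<^bold>-\<^bsub>B\<^esub> a = \<^bold>0\<^bsub>B\<^esub>" "a \<^bold>+\<^bsub>B\<^esub> \<^bold>-\<^bsub>B\<^esub> a = \<^bold>1\<^bsub>B\<^esub>"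
      by (auto simp: to_A closed A.mult_one A.add_zero A.mult_compl A.add_compl)
    show "contact B a a" if "a \<noteq> \<^bold>0\<^bsub>B\<^esub>"
      using that \<open>a \<in> \<phi> ` carrier A\<close> by (auto simp: to_A closed A.contact_refl)
    fix b assume "b \<in> \<phi> ` carrier A"
    with \<open>a \<in> \<phi> ` carrier A\<close> obtain x y where xy: "x \<in> carrier A" "a = \<phi> x" "y \<in> carrier A" "b = \<phi> y"
      by blast
    show "a \<^bold>+\<^bsub>B\<^esub> b \<in> \<phi> ` carrier A" "a \<^bold>*\<^bsub>B\<^esub> b \<in> \<phi> ` carrier A"
      using xy by (simp_all add: to_A closed)
    show "a \<^bold>+\<^bsub>B\<^esub> b = b \<^bold>+\<^bsub>B\<^esub> a" using xy A.add_commute[of x y] by (simp add: to_A closed)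
    show "a \<^bold>*\<^bsub>B\<^esub> b = b \<^bold>*\<^bsub>B\<^esub> a" using xy A.mult_commute[of x y] by (simp add: to_A closed)
    show "a \<noteq> \<^bold>0\<^bsub>B\<^esub> \<and> b \<noteq> \<^bold>0\<^bsub>B\<^esub>" if "contact B a b"
      using that xy A.contact_nonzero[of x y] by (simp add: to_A closed)
    show "contact B b a" if "contact B a b"
      using that xy A.contact_sym[of x y] by (simp add: to_A closed)
    fix c assume "c \<in> \<phi> ` carrier A"
    then obtain z where z: "z \<in> carrier A" "c = \<phi> z" by blast
    note xyz = xy(1,3) z(1)
    show "(a \<^bold>+\<^bsub>B\<^esub> b) \<^bold>+\<^bsub>B\<^esub> c = a \<^bold>+\<^bsub>B\<^esub> (b \<^bold>+\<^bsub>B\<^esub> c)"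
      using xy z A.add_assoc[OF xyz] by (simp add: to_A closed)
    show "(a \<^bold>*\<^bsub>B\<^esub> b) \<^bold>*\<^bsub>B\<^esub> c = a \<^bold>*\<^bsub>B\<^esub> (b \<^bold>*\<^bsub>B\<^esub> c)"
      using xy z A.mult_assoc[OF xyz] by (simp add: to_A closed)
    show "a \<^bold>*\<^bsub>B\<^esub> (b \<^bold>+\<^bsub>B\<^esub> c) = (a \<^bold>*\<^bsub>B\<^esub> b) \<^bold>+\<^bsub>B\<^esub> (a \<^bold>*\<^bsub>B\<^esub> c)"
      using xy z A.mult_add_distrib[OF xyz] by (simp add: to_A closed)
    show "a \<^bold>+\<^bsub>B\<^esub> (b \<^bold>*\<^bsub>B\<^esub> c) = (a \<^bold>+\<^bsub>B\<^esub> b) \<^bold>*\<^bsub>B\<^esub> (a \<^bold>+\<^bsub>B\<^esub> c)"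
      using xy z A.add_mult_distrib[OF xyz] by (simp add: to_A closed)
    show "contact B a (b \<^bold>+\<^bsub>B\<^esub> c) \<longleftrightarrow> contact B a b \<or> contact B a c"
      using xy z A.contact_add_right[OF xyz] by (simp add: to_A closed)
    show "contact B (a \<^bold>+\<^bsub>B\<^esub> b) c \<longleftrightarrow> contact B a c \<or> contact B b c"
      using xy z A.contact_add_left[OF xyz] by (simp add: to_A closed)
  qed
qed

lemma iso_ble:
  assumes "contact_algebra A" "CA_isomorphism \<phi> A B" "a \<in> carrier A" "b \<in> carrier A"
  shows "ble B (\<phi> a) (\<phi> b) \<longleftrightarrow> ble A a b"
proof -
  interpret A: contact_algebra A by fact
  show ?thesis
    using assms by (simp add: ble_def iso_inj A.add_closed flip: iso_add)
qed

lemma iso_image_Clan: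
  assumes A: "contact_algebra A" and iso: "CA_isomorphism \<phi> A B" and G: "\<Gamma> \<in> Clans A"
  shows "\<phi> ` \<Gamma> \<in> Clans B"
proof -
  interpret A: contact_algebra A by (rule A)
  interpret B: contact_algebra B using A iso by (rule CA_isomorphism_contact_algebra)
  have sub: "\<Gamma> \<subseteq> carrier A" using A.Clan_subset[OF G] .
  have mem: "\<phi> a \<in> \<phi> ` \<Gamma> \<longleftrightarrow> a \<in> \<Gamma>" if "a \<in> carrier A" for a
    using that sub iso_inj[OF iso] by blast
  show ?thesis
  proof (rule B.ClansI)
    show "\<phi> ` \<Gamma> \<subseteq> carrier B" using sub iso_image[OF iso] by blast
    show "\<phi> ` \<Gamma> \<noteq> {}" using A.Clan_one[OF G] by blast
    show "\<^bold>0\<^bsub>B\<^esub> \<notin> \<phi> ` \<Gamma>"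
      using mem[OF A.zero_closed] A.Clan_zero[OF G] iso_zero[OF iso] by simp
  next
    fix a b assume "a \<in> \<phi> ` \<Gamma>" "b \<in> carrier B" "ble B a b"
    then obtain x y where "x \<in> \<Gamma>" "a = \<phi> x" "y \<in> carrier A" "b = \<phi> y"
      using iso_image[OF iso] by blast
    with \<open>ble B a b\<close> show "b \<in> \<phi> ` \<Gamma>"
      using A.Clan_up[OF G, of x y] iso_ble[OF A iso, of x y] sub by auto
  next
    fix a b assume "a \<in> carrier B" "b \<in> carrier B" "a \<^bold>+\<^bsub>B\<^esub> b \<in> \<phi> ` \<Gamma>"
    moreover obtain x y where "x \<in> carrier A" "a = \<phi> x" "y \<in> carrier A" "b = \<phi> y"
      using calculation iso_image[OF iso] by blast
    ultimately show "a \<in> \<phi> ` \<Gamma> \<or> b \<in> \<phi> ` \<Gamma>"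
      using mem A.Clan_add[OF G] A.add_closed by (simp flip: iso_add[OF iso])
  next
    fix a b assume "a \<in> \<phi> ` \<Gamma>" "b \<in> \<phi> ` \<Gamma>"
    then show "contact B a b"
      using sub A.Clan_contact[OF G] iso_contact[OF iso] by blast
  qed
qed

lemma iso_image_Ult:
  assumes A: "contact_algebra A" and iso: "CA_isomorphism \<phi> A B" and U: "U \<in> Ult A"
  shows "\<phi> ` U \<in> Ult B"
proof -
  interpret A: contact_algebra A by (rule A)
  interpret B: contact_algebra B using A iso by (rule CA_isomorphism_contact_algebra)
  have C: "\<phi> ` U \<in> Clans B" using iso_image_Clan[OF A iso] A.Ult_subset_Clans U by blast
  have sub: "U \<subseteq> carrier A" using A.Ult_subset[OF U] .
  have "a \<^bold>*\<^bsub>B\<^esub> b \<in> \<phi> ` U" if ab: "a \<in> \<phi> ` U" "b \<in> \<phi> ` U" for a b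
  proof -
    obtain x y where "x \<in> U" "a = \<phi> x" "y \<in> U" "b = \<phi> y" using ab by blast
    moreover from this have "x \<in> carrier A" "y \<in> carrier A" using sub by auto
    ultimately show ?thesis
      using A.Ult_mult[OF U] by (simp flip: iso_mult[OF iso])
  qed
  \<comment> \<open>Every filter condition except closure under products is already part of being a
    clan.\<close>
  then have "proper_filter B (\<phi> ` U)"
    using C by (simp add: proper_filter_def Clans_def)
  moreover have "b \<in> \<phi> ` U \<or> \<^bold>-\<^bsub>B\<^esub> b \<in> \<phi> ` U" if "b \<in> carrier B" for b
  proof -
    obtain x where "x \<in> carrier A" "b = \<phi> x" using \<open>b \<in> carrier B\<close> iso_image[OF iso] by blast
    then show ?thesis
      using A.Ult_compl[OF U, of x] by (auto simp flip: iso_compl[OF iso])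
  qed
  ultimately show ?thesis by (simp add: B.Ult_iff)
qed

text \<open>The inverse isomorphism acts by direct image too, and the two image maps cancel on
  subsets of the carriers. For ultrafilters the equality of sets is the form that
  \<open>CS_isomorphic\<close> requires.\<close>

lemma
  assumes A: "contact_algebra A" and iso: "CA_isomorphism \<phi> A B"
  shows bij_betw_Clans: "bij_betw ((`) \<phi>) (Clans A) (Clans B)"
    and iso_image_Ults: "(`) \<phi> ` Ult A = Ult B"
proof -
  let ?\<psi> = "inv_into (carrier A) \<phi>"
  interpret A: contact_algebra A by (rule A)
  have B: "contact_algebra B" using A iso by (rule CA_isomorphism_contact_algebra)
  then interpret B: contact_algebra B .
  have iso': "CA_isomorphism ?\<psi> B A" using A iso by (rule CA_isomorphism_inv)
  have l: "?\<psi> ` \<phi> ` S = S" if "S \<subseteq> carrier A" for S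
    using that iso_bij[OF iso] by (simp add: bij_betw_def inv_into_image_cancel)
  have r: "\<phi> ` ?\<psi> ` S = S" if "S \<subseteq> carrier B" for S
    using that iso_image[OF iso] by (simp add: image_inv_into_cancel)
  show "bij_betw ((`) \<phi>) (Clans A) (Clans B)"
  proof (rule bij_betw_byWitness[where f' = "(`) ?\<psi>"])
    show "\<forall>\<Gamma>\<in>Clans A. ?\<psi> ` \<phi> ` \<Gamma> = \<Gamma>" using l A.Clan_subset by blast
    show "\<forall>\<Gamma>\<in>Clans B. \<phi> ` ?\<psi> ` \<Gamma> = \<Gamma>" using r B.Clan_subset by blast
    show "(`) \<phi> ` Clans A \<subseteq> Clans B" using iso_image_Clan[OF A iso] by blast
    show "(`) ?\<psi> ` Clans B \<subseteq> Clans A" using iso_image_Clan[OF B iso'] by blast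
  qed
  show "(`) \<phi> ` Ult A = Ult B"
  proof
    show "(`) \<phi> ` Ult A \<subseteq> Ult B" using iso_image_Ult[OF A iso] by blast
    show "Ult B \<subseteq> (`) \<phi> ` Ult A"
      using iso_image_Ult[OF B iso'] r B.Ult_subset by (metis imageI subsetI)
  qed
qed

section \<open>The clopen algebra and the canonical contact algebra of a pair\<close>

lemma clopen_CA_simps [simp]:
  "carrier (clopen_CA (X, S)) = CO (subtopology X S)"
  "\<^bold>0\<^bsub>clopen_CA (X, S)\<^esub> = {}"
  "\<^bold>1\<^bsub>clopen_CA (X, S)\<^esub> = S"
  "F \<^bold>+\<^bsub>clopen_CA (X, S)\<^esub> G = F \<union> G"
  "F \<^bold>*\<^bsub>clopen_CA (X, S)\<^esub> G = F \<inter> G"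
  "\<^bold>-\<^bsub>clopen_CA (X, S)\<^esub> F = S - F"
  "contact (clopen_CA (X, S)) F G \<longleftrightarrow> X closure_of F \<inter> X closure_of G \<noteq> {}"
  by (simp_all add: clopen_CA_def)

lemma canonical_CA_simps [simp]:
  "carrier (canonical_CA (X, S)) = RC_pair (X, S)"
  "\<^bold>0\<^bsub>canonical_CA (X, S)\<^esub> = {}"
  "\<^bold>1\<^bsub>canonical_CA (X, S)\<^esub> = topspace X"
  "F \<^bold>+\<^bsub>canonical_CA (X, S)\<^esub> G = F \<union> G"
  "F \<^bold>*\<^bsub>canonical_CA (X, S)\<^esub> G = X closure_of (X interior_of (F \<inter> G))"
  "\<^bold>-\<^bsub>canonical_CA (X, S)\<^esub> F = X closure_of (topspace X - F)"
  "contact (canonical_CA (X, S)) F G \<longleftrightarrow> F \<inter> G \<noteq> {}"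
  by (simp_all add: canonical_CA_def)

lemma ble_sets [simp]:
  "ble (clopen_CA (X, S)) F G \<longleftrightarrow> F \<subseteq> G"
  "ble (canonical_CA (X, S)) F G \<longleftrightarrow> F \<subseteq> G"
  by (auto simp: ble_def)

lemma RC_pair_eq: "RC_pair (X, S) = (\<lambda>A. X closure_of A) ` CO (subtopology X S)"
  by (simp add: RC_pair_def)

lemma
  assumes "S \<subseteq> topspace X"
  shows CO_whole: "S \<in> CO (subtopology X S)"
    and CO_subset: "A \<in> CO (subtopology X S) \<Longrightarrow> A \<subseteq> S"
    and CO_compl: "A \<in> CO (subtopology X S) \<Longrightarrow> S - A \<in> CO (subtopology X S)"
    and closure_of_CO: "A \<in> CO (subtopology X S) \<Longrightarrow> S \<inter> X closure_of A = A"
proof -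
  have top: "topspace (subtopology X S) = S" using assms by auto
  show "S \<in> CO (subtopology X S)"
    using openin_topspace[of "subtopology X S"] closedin_topspace[of "subtopology X S"]
    unfolding top by (simp add: CO_def)
  show sub: "A \<subseteq> S" if "A \<in> CO (subtopology X S)"
    using that openin_subset[of "subtopology X S" A] unfolding top by (simp add: CO_def)
  show "S - A \<in> CO (subtopology X S)" if "A \<in> CO (subtopology X S)"
    using that openin_diff[of "subtopology X S" S A] closedin_diff[of "subtopology X S" S A]
      openin_topspace[of "subtopology X S"] closedin_topspace[of "subtopology X S"]
    unfolding top by (simp add: CO_def)
  show "S \<inter> X closure_of A = A" if "A \<in> CO (subtopology X S)"
  proof -
    have "subtopology X S closure_of A = A"
      using that by (simp add: CO_def closure_of_eq)
    then show ?thesis using sub[OF that] by (simp add: closure_of_subtopology Int_absorb1)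
  qed
qed

lemma CO_empty: "{} \<in> CO X"
  and CO_Un: "\<lbrakk>A \<in> CO X; A' \<in> CO X\<rbrakk> \<Longrightarrow> A \<union> A' \<in> CO X"
  and CO_Int: "\<lbrakk>A \<in> CO X; A' \<in> CO X\<rbrakk> \<Longrightarrow> A \<inter> A' \<in> CO X"
  by (simp_all add: CO_def openin_Un closedin_Un openin_Int closedin_Int)

lemma topological_pairD:
  assumes "topological_pair (X, S)"
  shows "S \<subseteq> topspace X" "X closure_of S = topspace X"
  using assms by (simp_all add: topological_pair_def)

lemma contact_algebra_clopen_CA:
  assumes P: "topological_pair (X, S)"
  shows "contact_algebra (clopen_CA (X, S))"
proof -
  note S = topological_pairD[OF P]
  \<comment> \<open>Needed for reflexivity of contact: a nonempty subset of the space has nonempty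
    closure.\<close>
  have ne: "X closure_of A \<noteq> {}" if "A \<in> CO (subtopology X S)" "A \<noteq> {}" for A
    using that CO_subset[OF S(1) that(1)] S(1) closure_of_eq_empty[of A X] by auto
  show ?thesis
    by unfold_locales
      (use ne in \<open>auto simp: CO_empty CO_Un CO_Int CO_compl[OF S(1)] CO_whole[OF S(1)]
        dest: CO_subset[OF S(1)]\<close>)
qed

text \<open>The open set outside the closure of \<open>A\<close> meets \<open>S\<close> exactly in
  \<open>S - A\<close>, because \<open>A\<close> is the trace of its closure, and intersecting an
  open set with a dense set does not change its closure. This is the complement law for the closure
  isomorphism.\<close>

lemma closure_of_diff_dense:
  assumes P: "topological_pair (X, S)" and A: "A \<in> CO (subtopology X S)"
  shows "X closure_of (S - A) = X closure_of (topspace X - X closure_of A)"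
proof -
  note S = topological_pairD[OF P]
  let ?V = "topspace X - X closure_of A"
  have "X closure_of (?V \<inter> S) = X closure_of ?V"
    using S(2) by (intro closure_of_openin_Int_superset) auto
  moreover have "?V \<inter> S = S - A"
    using S(1) closure_of_CO[OF S(1) A] by auto
  ultimately show ?thesis by simp
qed

text \<open>De Morgan's law in \<open>RC(X)\<close>: it writes the meet through complements and
  unions, so that preservation of meets by closure reduces to preservation of these two.\<close>

lemma closure_of_interior_of_Int:
  assumes "F \<subseteq> topspace X" "G \<subseteq> topspace X"
  shows "X closure_of (X interior_of (F \<inter> G)) =
    X closure_of (topspace X - (X closure_of (topspace X - F) \<union> X closure_of (topspace X - G)))"
proof -
  have "topspace X - (topspace X - F \<union> (topspace X - G)) = F \<inter> G" using assms by blast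
  then show ?thesis
    by (metis Diff_Int closure_of_Un interior_of_closure_of)
qed

lemma closure_of_CA_isomorphism:
  assumes P: "topological_pair (X, S)"
  shows "CA_isomorphism (\<lambda>A. X closure_of A) (clopen_CA (X, S)) (canonical_CA (X, S))"
proof (rule CA_isomorphismI; simp?)
  note S = topological_pairD[OF P]
  show "bij_betw ((closure_of) X) (CO (subtopology X S)) (RC_pair (X, S))"
    unfolding bij_betw_def RC_pair_eq
    using closure_of_CO[OF S(1)] by (metis (no_types, lifting) inj_onI)
  show "X closure_of S = topspace X" by (rule S(2))
  show compl: "X closure_of (S - A) = X closure_of (topspace X - X closure_of A)"
    if "A \<in> CO (subtopology X S)" for A
    using P that by (rule closure_of_diff_dense)
  show "X closure_of (A \<inter> A') = X closure_of (X interior_of (X closure_of A \<inter> X closure_of A'))"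
    if A: "A \<in> CO (subtopology X S)" "A' \<in> CO (subtopology X S)" for A A'
  proof -
    note C = CO_compl[OF S(1)]
    have "A \<inter> A' = S - ((S - A) \<union> (S - A'))"
      using A CO_subset[OF S(1)] by blast
    then have "X closure_of (A \<inter> A') =
        X closure_of (topspace X - (X closure_of (S - A) \<union> X closure_of (S - A')))"
      using compl[OF CO_Un[OF C[OF A(1)] C[OF A(2)]]] by simp
    also have "\<dots> = X closure_of (X interior_of (X closure_of A \<inter> X closure_of A'))"
      unfolding compl[OF A(1)] compl[OF A(2)]
      by (rule closure_of_interior_of_Int[symmetric]) (rule closure_of_subset_topspace)+
    finally show ?thesis .
  qed
qed

lemma contact_algebra_canonical_CA:
  "topological_pair (X, S) \<Longrightarrow> contact_algebra (canonical_CA (X, S))"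
  using contact_algebra_clopen_CA closure_of_CA_isomorphism CA_isomorphism_contact_algebra by blast

text \<open>For a point of \<open>S\<close>, lying in the closure of a clopen subset of
  \<open>S\<close> is the same as lying in the subset, and membership of a point is
  two-valued.\<close>

lemma point_clan_in_Ult:
  assumes P: "topological_pair (X, S)" and x: "x \<in> S"
  shows "point_clan (X, S) x \<in> Ult (clopen_CA (X, S))"
proof -
  note S = topological_pairD[OF P]
  interpret contact_algebra "clopen_CA (X, S)" using P by (rule contact_algebra_clopen_CA)
  have "point_clan (X, S) x = {A \<in> CO (subtopology X S). x \<in> A}"
    using x closure_of_CO[OF S(1)] by (auto simp: point_clan_def)
  then show ?thesis
    using x CO_whole[OF S(1)] CO_compl[OF S(1)]
    by (auto simp: Ult_iff proper_filter_def CO_Int)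
qed

text \<open>An ultrafilter of clopen sets has the finite intersection property, so compactness
  yields a point in all its members. Its point clan contains the ultrafilter and, by two-valuedness,
  equals it.\<close>

lemma Ult_clopen_CA:
  assumes P: "topological_pair (X, S)" and cpt: "compact_space (subtopology X S)"
  shows "Ult (clopen_CA (X, S)) = point_clan (X, S) ` S"
proof
  note S = topological_pairD[OF P]
  interpret contact_algebra "clopen_CA (X, S)" using P by (rule contact_algebra_clopen_CA)
  show "point_clan (X, S) ` S \<subseteq> Ult (clopen_CA (X, S))" using point_clan_in_Ult[OF P] by blast
  show "Ult (clopen_CA (X, S)) \<subseteq> point_clan (X, S) ` S"
  proof
    fix U assume U: "U \<in> Ult (clopen_CA (X, S))"
    have sub: "U \<subseteq> CO (subtopology X S)" using Ult_subset[OF U] by simp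
    \<comment> \<open>The factor \<open>S\<close> is the unit of the algebra and gives the right
      value for the empty family.\<close>
    have fin: "S \<inter> \<Inter>\<F> \<in> U" if "finite \<F>" "\<F> \<subseteq> U" for \<F>
      using that
    proof induction
      case empty
      then show ?case using Ult_one[OF U] by simp
    next
      case (insert A \<F>)
      then have "A \<inter> (S \<inter> \<Inter>\<F>) \<in> U"
        using Ult_mult[OF U, of A "S \<inter> \<Inter>\<F>"] sub by auto
      then show ?case by (simp add: Int_left_commute)
    qed
    have "\<Inter>U \<noteq> {}"
    proof (rule cpt[unfolded compact_space_fip, rule_format], intro conjI ballI allI impI)
      show "closedin (subtopology X S) C" if "C \<in> U" for C
        using that sub by (auto simp: CO_def)
      show "\<Inter>\<F> \<noteq> {}" if "finite \<F> \<and> \<F> \<subseteq> U" for \<F>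
        using fin[of \<F>] that Ult_zero[OF U] by auto
    qed
    then obtain x where x: "x \<in> \<Inter>U" by blast
    then have xS: "x \<in> S" using Ult_one[OF U] by auto
    have "point_clan (X, S) x = U"
    proof
      show "U \<subseteq> point_clan (X, S) x"
        using x sub closure_of_CO[OF S(1)] by (auto simp: point_clan_def)
      show "point_clan (X, S) x \<subseteq> U"
      proof
        fix A assume "A \<in> point_clan (X, S) x"
        then have A: "A \<in> CO (subtopology X S)" "x \<in> A"
          using xS closure_of_CO[OF S(1)] by (auto simp: point_clan_def)
        then have "S - A \<notin> U" using x by auto
        then show "A \<in> U" using Ult_compl[OF U, of A] A by simp
      qed
    qed
    then show "U \<in> point_clan (X, S) ` S" using xS by blast
  qed
qed

text \<open>Closed sets are intersections of basic ones, and images under an injective map commute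
  with such intersections; so matching the two bases makes the map both continuous and
  closed.\<close>

lemma homeomorphic_map_closed_base:
  assumes bij: "bij_betw f (topspace X) (topspace Y)"
    and C: "closed_base X \<C>" and D: "closed_base Y \<D>" and im: "(`) f ` \<C> = \<D>"
  shows "homeomorphic_map X Y f"
proof (rule bijective_closed_imp_homeomorphic_map)
  show surj: "f ` topspace X = topspace Y" and inj: "inj_on f (topspace X)"
    using bij by (auto simp: bij_betw_def)
  have cl: "closedin X A" "closedin Y (f ` A)" if "A \<in> \<C>" for A
    using that C D im by (auto simp: closed_base_def)
  then have sub: "A \<subseteq> topspace X" if "A \<in> \<C>" for A
    using that closedin_subset by blast
  then have mem: "f x \<in> f ` A \<longleftrightarrow> x \<in> A" if "x \<in> topspace X" "A \<in> \<C>" for x A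
    using that inj_on_image_mem_iff[OF inj] by blast
  show "continuous_map X Y f"
    unfolding continuous_map_closedin
  proof (intro conjI allI impI)
    show "f \<in> topspace X \<rightarrow> topspace Y" using surj by auto
    fix F assume "closedin Y F"
    then obtain \<G> where \<G>: "\<G> \<subseteq> \<D>" "F = topspace Y \<inter> \<Inter>\<G>"
      using D by (auto simp: closed_base_def)
    obtain \<G>' where \<G>': "\<G>' \<subseteq> \<C>" "\<G> = (`) f ` \<G>'"
      using \<G>(1) im by (metis subset_image_iff)
    have "f x \<in> f ` A \<longleftrightarrow> x \<in> A" if "x \<in> topspace X" "A \<in> \<G>'" for x A
      using that mem \<G>'(1) by blast
    \<comment> \<open>Inserting the whole space covers an empty \<G>' and makes the family nonempty,
      as \<open>closedin_Inter\<close> demands.\<close>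
    then have "{x \<in> topspace X. f x \<in> F} = \<Inter>(insert (topspace X) \<G>')"
      using surj unfolding \<G>(2) \<G>'(2) by auto
    also have "closedin X \<dots>" using cl(1) \<G>'(1) by (intro closedin_Inter) auto
    finally show "closedin X {x \<in> topspace X. f x \<in> F}" .
  qed
  show "closed_map X Y f"
    unfolding closed_map_def
  proof (intro allI impI)
    fix F assume "closedin X F"
    then obtain \<G> where \<G>: "\<G> \<subseteq> \<C>" "F = topspace X \<inter> \<Inter>\<G>"
      using C by (auto simp: closed_base_def)
    have "f x \<in> f ` A \<longleftrightarrow> x \<in> A" if "x \<in> topspace X" "A \<in> \<G>" for x A
      using that mem \<G>(1) by blast
    then have "f ` F = \<Inter>(insert (topspace Y) ((`) f ` \<G>))"
      unfolding \<G>(2) surj[symmetric] by auto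
    also have "closedin Y \<dots>" using cl(2) \<G>(1) by (intro closedin_Inter) auto
    finally show "closedin Y (f ` F)" .
  qed
qed

section \<open>The canonical 2-contact space\<close>

context contact_algebra
begin

definition stone_map :: "'a \<Rightarrow> 'a set set"
  where "stone_map a = {U \<in> Ult B. a \<in> U}"

abbreviation stone_top :: "'a set topology"
  where "stone_top \<equiv> subtopology (clan_topology B) (Ult B)"

lemma topspace_stone_top: "topspace stone_top = Ult B"
  using Ult_subset_Clans by (auto simp: topspace_clan_topology)

lemma clan_map_Int_Ult: "Ult B \<inter> clan_map B a = stone_map a"
  using Ult_subset_Clans by (auto simp: clan_map_def stone_map_def)

lemma stone_map_subset_iff:
  "\<lbrakk>a \<in> carrier B; b \<in> carrier B\<rbrakk> \<Longrightarrow> stone_map a \<subseteq> stone_map b \<longleftrightarrow> ble B a b"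
  by (auto simp: stone_map_def Ult_ble_iff)

text \<open>An intersection of basic sets is coded by the set \<open>D\<close> of their indices,
  which turns closure and compactness arguments into inclusions between sets of elements.\<close>

lemma closedin_clan_topology:
  "closedin (clan_topology B) F \<longleftrightarrow> (\<exists>D\<subseteq>carrier B. F = {\<Gamma> \<in> Clans B. D \<subseteq> \<Gamma>})"
proof -
  have *: "Clans B \<inter> \<Inter>(clan_map B ` D) = {\<Gamma> \<in> Clans B. D \<subseteq> \<Gamma>}" for D
    by (auto simp: clan_map_def)
  have "closedin (clan_topology B) F \<longleftrightarrow> (\<exists>D\<subseteq>carrier B. F = Clans B \<inter> \<Inter>(clan_map B ` D))"
  proof
    assume "closedin (clan_topology B) F"
    then obtain \<G> where "\<G> \<subseteq> clan_map B ` carrier B" "F = Clans B \<inter> \<Inter>\<G>"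
      using closed_base_clan_topology unfolding closed_base_def topspace_clan_topology by blast
    then show "\<exists>D\<subseteq>carrier B. F = Clans B \<inter> \<Inter>(clan_map B ` D)" by (metis subset_image_iff)
  next
    assume "\<exists>D\<subseteq>carrier B. F = Clans B \<inter> \<Inter>(clan_map B ` D)"
    then obtain D where D: "D \<subseteq> carrier B" "F = \<Inter>(insert (Clans B) (clan_map B ` D))" by auto
    have "closedin (clan_topology B) C" if "C \<in> insert (Clans B) (clan_map B ` D)" for C
      using that D(1) closed_base_clan_topology closedin_topspace[of "clan_topology B"]
      by (auto simp: closed_base_def topspace_clan_topology)
    then show "closedin (clan_topology B) F"
      unfolding D(2) by (intro closedin_Inter) auto
  qed
  then show ?thesis by (simp only: *)
qed

text \<open>If a closed set coded by \<open>D\<close> contains every ultrafilter through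
  \<open>a\<close>, then \<open>a\<close> lies below each member of \<open>D\<close> by the Stone
  representation. Clans are upward closed, so each clan through \<open>a\<close> contains
  \<open>D\<close> as well.\<close>

lemma closure_of_stone_map: "a \<in> carrier B \<Longrightarrow> clan_topology B closure_of stone_map a = clan_map B a"
proof (rule closure_of_unique)
  assume a: "a \<in> carrier B"
  show "stone_map a \<subseteq> clan_map B a" using clan_map_Int_Ult by blast
  show "closedin (clan_topology B) (clan_map B a)"
    using a unfolding closedin_clan_topology by (intro exI[of _ "{a}"]) (auto simp: clan_map_def)
  fix T assume T: "stone_map a \<subseteq> T" "closedin (clan_topology B) T"
  then obtain D where D: "D \<subseteq> carrier B" "T = {\<Gamma> \<in> Clans B. D \<subseteq> \<Gamma>}"
    unfolding closedin_clan_topology by blast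
  have "ble B a d" if "d \<in> D" for d
  proof -
    have "stone_map a \<subseteq> stone_map d"
      using T(1) D(2) that by (auto simp: stone_map_def)
    then show ?thesis using stone_map_subset_iff a that D(1) by blast
  qed
  then have "D \<subseteq> \<Gamma>" if "\<Gamma> \<in> Clans B" "a \<in> \<Gamma>" for \<Gamma>
    using Clan_up[OF that(1,2)] D(1) by auto
  then show "clan_map B a \<subseteq> T" unfolding D(2) by (auto simp: clan_map_def)
qed

lemma stone_map_one: "stone_map \<^bold>1 = Ult B" and clan_map_one: "clan_map B \<^bold>1 = Clans B"
  using Ult_one Clan_one by (auto simp: stone_map_def clan_map_def)

text \<open>Density of the ultrafilters is the preceding closure computation at the unit.\<close>

lemma topological_pair_canonical_CS: "topological_pair (clan_topology B, Ult B)"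
  using closure_of_stone_map[OF one_closed] Ult_subset_Clans
  by (simp add: topological_pair_def topspace_clan_topology stone_map_one clan_map_one)

lemma closedin_stone_top:
  "closedin stone_top C \<longleftrightarrow> (\<exists>D\<subseteq>carrier B. C = {U \<in> Ult B. D \<subseteq> U})"
proof -
  have *: "{\<Gamma> \<in> Clans B. D \<subseteq> \<Gamma>} \<inter> Ult B = {U \<in> Ult B. D \<subseteq> U}" for D
    using Ult_subset_Clans by auto
  show ?thesis
    unfolding closedin_subtopology closedin_clan_topology by (metis *)
qed

lemma stone_map_compl: "a \<in> carrier B \<Longrightarrow> stone_map (\<^bold>- a) = Ult B - stone_map a"
  by (auto simp: stone_map_def Ult_compl)

lemma stone_map_CO:
  assumes a: "a \<in> carrier B"
  shows "stone_map a \<in> CO stone_top"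
proof -
  have closed: "closedin stone_top (stone_map b)" if "b \<in> carrier B" for b
    using that unfolding closedin_stone_top by (intro exI[of _ "{b}"]) (auto simp: stone_map_def)
  have "openin stone_top (stone_map a)"
    unfolding openin_closedin_eq topspace_stone_top stone_map_compl[OF a, symmetric]
    using closed compl_closed[OF a] by (auto simp: stone_map_def)
  with closed[OF a] show ?thesis by (simp add: CO_def)
qed

text \<open>The elements whose Stone set contains a finite intersection of the family form a proper
  filter, and any ultrafilter extending it lies in every member of the family.\<close>

lemma compact_stone_top: "compact_space stone_top"
  unfolding compact_space_fip
proof (intro allI impI, elim conjE)
  fix \<U> assume closed: "\<forall>C\<in>\<U>. closedin stone_top C"
    and fip: "\<forall>\<F>. finite \<F> \<and> \<F> \<subseteq> \<U> \<longrightarrow> \<Inter>\<F> \<noteq> {}"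
  show "\<Inter>\<U> \<noteq> {}"
  proof (cases "\<U> = {}")
    case False
    then obtain C0 where C0: "C0 \<in> \<U>" by blast
    have sub: "C \<subseteq> Ult B" if "C \<in> \<U>" for C
      using closed that closedin_subset topspace_stone_top by blast
    \<comment> \<open>The factor \<open>Ult B\<close> lets the empty subfamily stand for the whole
      space, which puts the unit into \<open>?F\<close>.\<close>
    let ?F = "{x \<in> carrier B. \<exists>\<F>. finite \<F> \<and> \<F> \<subseteq> \<U> \<and> Ult B \<inter> \<Inter>\<F> \<subseteq> stone_map x}"
    have F: "proper_filter B ?F"
      unfolding proper_filter_def
    proof (intro conjI ballI impI)
      have "\<^bold>1 \<in> ?F" using one_closed stone_map_one by (auto intro!: exI[of _ "{}"])
      then show "?F \<noteq> {}" by blast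
      show "\<^bold>0 \<notin> ?F"
      proof
        assume "\<^bold>0 \<in> ?F"
        then obtain \<F> where \<F>: "finite \<F>" "\<F> \<subseteq> \<U>" "Ult B \<inter> \<Inter>\<F> \<subseteq> stone_map \<^bold>0" by blast
        moreover have "stone_map \<^bold>0 = {}" using Ult_zero by (auto simp: stone_map_def)
        \<comment> \<open>Since \<open>C0\<close> consists of ultrafilters, adding it to the
          subfamily replaces the factor \<open>Ult B\<close> and yields a finite family violating
          the intersection property.\<close>
        ultimately have "\<Inter>(insert C0 \<F>) = {}" using sub[OF C0] by auto
        then show False using fip \<F>(1,2) C0 by (metis finite_insert insert_subset)
      qed
      fix x assume x: "x \<in> ?F"
      show "y \<in> ?F" if y: "y \<in> carrier B" "ble B x y" for y
      proof -
        have "stone_map x \<subseteq> stone_map y" using x y stone_map_subset_iff[of x y] by simp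
        then show ?thesis using x y(1) by (blast intro: order_trans)
      qed
      show "x \<^bold>* y \<in> ?F" if y: "y \<in> ?F" for y
      proof -
        obtain \<F> \<G> where "finite \<F>" "\<F> \<subseteq> \<U>" "Ult B \<inter> \<Inter>\<F> \<subseteq> stone_map x"
          "finite \<G>" "\<G> \<subseteq> \<U>" "Ult B \<inter> \<Inter>\<G> \<subseteq> stone_map y"
          using x y by auto
        moreover have "stone_map (x \<^bold>* y) = stone_map x \<inter> stone_map y"
          using x y by (auto simp: stone_map_def Ult_mult)
        ultimately have "finite (\<F> \<union> \<G>)" "\<F> \<union> \<G> \<subseteq> \<U>" "Ult B \<inter> \<Inter>(\<F> \<union> \<G>) \<subseteq> stone_map (x \<^bold>* y)"
          by auto
        then show ?thesis using x y mult_closed by blast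
      qed
    qed auto
    then obtain U where "proper_filter B U" and FU: "?F \<subseteq> U"
      and "\<And>b. b \<in> carrier B \<Longrightarrow> b \<in> U \<or> \<^bold>- b \<in> U"
      using filter_extends by blast
    then have U: "U \<in> Ult B" by (simp add: Ult_iff)
    have "U \<in> C" if C: "C \<in> \<U>" for C
    proof -
      have "closedin stone_top C" using closed C by simp
      then obtain D where D: "D \<subseteq> carrier B" "C = {U \<in> Ult B. D \<subseteq> U}"
        unfolding closedin_stone_top by blast
      have "d \<in> ?F" if d: "d \<in> D" for d
      proof -
        have "Ult B \<inter> \<Inter>{C} \<subseteq> stone_map d" using d by (auto simp: D(2) stone_map_def)
        moreover have "finite {C}" "{C} \<subseteq> \<U>" using C by auto
        ultimately show ?thesis using d D(1) by blast
      qed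
      then have "D \<subseteq> U" using FU by blast
      then show ?thesis using U D(2) by blast
    qed
    then show ?thesis by blast
  qed simp
qed

text \<open>An ultrafilter omits some d in \<open>D\<close> iff it contains the complement of some
  d, so the complement of a closed set is a union of Stone sets.\<close>

lemma openin_stone_top_Union:
  assumes "openin stone_top W"
  obtains D where "D \<subseteq> carrier B" "W = \<Union>(stone_map ` D)"
proof -
  have "closedin stone_top (Ult B - W)" "W \<subseteq> Ult B"
    using assms unfolding openin_closedin_eq topspace_stone_top by auto
  then obtain D where D: "D \<subseteq> carrier B" "Ult B - W = {U \<in> Ult B. D \<subseteq> U}"
    unfolding closedin_stone_top by blast
  have "W = Ult B - {U \<in> Ult B. D \<subseteq> U}" using D(2) \<open>W \<subseteq> Ult B\<close> by blast
  also have "\<dots> = \<Union>(stone_map ` bcompl B ` D)"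
    using D(1) Ult_compl by (auto simp: stone_map_def)
  finally show thesis using that[of "bcompl B ` D"] D(1) compl_closed by blast
qed

text \<open>A clopen set is compact and covered by Stone sets inside it, so finitely many suffice,
  and a finite union of Stone sets is the Stone set of a sum.\<close>

lemma CO_stone_top: "CO stone_top = stone_map ` carrier B"
proof
  show "stone_map ` carrier B \<subseteq> CO stone_top" using stone_map_CO by blast
  have fin: "\<Union>\<F> \<in> stone_map ` carrier B" if "finite \<F>" "\<F> \<subseteq> stone_map ` carrier B" for \<F>
    using that
  proof induction
    case empty
    have "{} = stone_map \<^bold>0" using Ult_zero by (auto simp: stone_map_def)
    then show ?case using zero_closed by auto
  next
    case (insert A \<F>)
    then obtain a b where ab: "a \<in> carrier B" "A = stone_map a" "b \<in> carrier B" "\<Union>\<F> = stone_map b"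
      by blast
    then have "\<Union>(insert A \<F>) = stone_map (a \<^bold>+ b)"
      by (auto simp: stone_map_def Ult_add)
    then show ?case using ab add_closed by blast
  qed
  show "CO stone_top \<subseteq> stone_map ` carrier B"
  proof
    fix A assume "A \<in> CO stone_top"
    then have A: "openin stone_top A" "closedin stone_top A" by (auto simp: CO_def)
    obtain D where D: "D \<subseteq> carrier B" "A = \<Union>(stone_map ` D)"
      using openin_stone_top_Union[OF A(1)] by blast
    have "compactin stone_top A" using closedin_compact_space[OF compact_stone_top A(2)] .
    moreover have "\<forall>W\<in>stone_map ` D. openin stone_top W"
      using D(1) stone_map_CO by (auto simp: CO_def)
    moreover have "A \<subseteq> \<Union>(stone_map ` D)" using D(2) by simp
    ultimately obtain \<F> where \<F>: "finite \<F>" "\<F> \<subseteq> stone_map ` D" "A \<subseteq> \<Union>\<F>"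
      unfolding compactin_def by meson
    then have "\<Union>\<F> \<subseteq> A" using D(2) Union_mono by metis
    with \<F>(3) have "A = \<Union>\<F>" by (rule subset_antisym)
    moreover have "\<F> \<subseteq> stone_map ` carrier B" using \<F>(2) D(1) by blast
    ultimately show "A \<in> stone_map ` carrier B" using fin[OF \<F>(1)] by simp
  qed
qed

lemma Stone_space_stone_top: "Stone_space stone_top"
  unfolding Stone_space_def
proof (intro conjI)
  show "compact_space stone_top" by (rule compact_stone_top)
  show "Hausdorff_space stone_top"
    unfolding Hausdorff_space_def topspace_stone_top
  proof (intro allI impI, elim conjE)
    fix U V assume U: "U \<in> Ult B" and V: "V \<in> Ult B" and ne: "U \<noteq> V"
    have "\<exists>a\<in>carrier B. a \<in> U \<longleftrightarrow> a \<notin> V"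
      using ne Ult_subset[OF U] Ult_subset[OF V] by blast
    \<comment> \<open>If the distinguishing element lies in \<open>V\<close> instead of
      \<open>U\<close>, its complement is taken.\<close>
    then obtain a where a: "a \<in> carrier B" "a \<in> U" "a \<notin> V"
      using Ult_compl[OF U] Ult_compl[OF V] compl_closed by metis
    show "\<exists>W W'. openin stone_top W \<and> openin stone_top W' \<and> U \<in> W \<and> V \<in> W' \<and> disjnt W W'"
    proof (intro exI conjI)
      show "openin stone_top (stone_map a)" "openin stone_top (stone_map (\<^bold>- a))"
        using stone_map_CO compl_closed a(1) by (auto simp: CO_def)
      show "U \<in> stone_map a" using U a by (simp add: stone_map_def)
      show "V \<in> stone_map (\<^bold>- a)" using V a by (simp add: stone_map_def Ult_compl)
      show "disjnt (stone_map a) (stone_map (\<^bold>- a))"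
        using a(1) by (auto simp: stone_map_compl disjnt_def)
    qed
  qed
  show "openin stone_top = arbitrary union_of (\<lambda>W. W \<in> CO stone_top)"
  proof (intro ext iffI)
    fix W assume "openin stone_top W"
    then obtain D where "D \<subseteq> carrier B" "W = \<Union>(stone_map ` D)"
      by (rule openin_stone_top_Union)
    then show "(arbitrary union_of (\<lambda>W. W \<in> CO stone_top)) W"
      unfolding union_of_def arbitrary_def using stone_map_CO by (auto intro!: exI[of _ "stone_map ` D"])
  next
    fix W assume "(arbitrary union_of (\<lambda>W. W \<in> CO stone_top)) W"
    then show "openin stone_top W" by (auto simp: union_of_def CO_def)
  qed
qed

text \<open>The closures of two Stone sets are the sets of clans through the two elements, so they
  meet iff there is a common clan, that is, iff the elements are in contact.\<close>

lemma stone_map_CA_isomorphism: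
  "CA_isomorphism stone_map B (clopen_CA (canonical_CS B))"
  unfolding canonical_CS_def
proof (rule CA_isomorphismI; simp?)
  have "a = b" if "a \<in> carrier B" "b \<in> carrier B" "stone_map a = stone_map b" for a b
    using that stone_map_subset_iff[of a b] stone_map_subset_iff[of b a] ble_antisym[of a b] by simp
  then show "bij_betw stone_map (carrier B) (CO stone_top)"
    by (simp add: bij_betw_def CO_stone_top inj_onI)
  show "stone_map \<^bold>0 = {}" using Ult_zero by (auto simp: stone_map_def)
  show "stone_map \<^bold>1 = Ult B" by (rule stone_map_one)
  show "stone_map (\<^bold>- a) = Ult B - stone_map a" if "a \<in> carrier B" for a
    using that by (rule stone_map_compl)
  fix a b assume ab: "a \<in> carrier B" "b \<in> carrier B"
  show "stone_map (a \<^bold>+ b) = stone_map a \<union> stone_map b"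
    "stone_map (a \<^bold>* b) = stone_map a \<inter> stone_map b"
    using ab by (auto simp: stone_map_def Ult_add Ult_mult)
  show "contact B a b \<longleftrightarrow>
      clan_topology B closure_of stone_map a \<inter> clan_topology B closure_of stone_map b \<noteq> {}"
    unfolding closure_of_stone_map[OF ab(1)] closure_of_stone_map[OF ab(2)] contact_iff_Clan[OF ab]
    by (auto simp: clan_map_def)
qed

lemma clan_map_CA_isomorphism:
  "CA_isomorphism (clan_map B) B (canonical_CA (canonical_CS B))"
proof -
  have "clan_map B = (\<lambda>A. clan_topology B closure_of A) \<circ> stone_map"
  proof
    fix a
    show "clan_map B a = ((\<lambda>A. clan_topology B closure_of A) \<circ> stone_map) a"
    \<comment> \<open>The two sides are compared as total functions; off the carrier both are empty,
      as clans and ultrafilters are subsets of the carrier.\<close>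
    proof (cases "a \<in> carrier B")
      case False
      then have "clan_map B a = {}" "stone_map a = {}"
        using Clan_subset Ult_subset by (auto simp: clan_map_def stone_map_def)
      then show ?thesis by simp
    qed (simp add: closure_of_stone_map)
  qed
  then show ?thesis
    using CA_isomorphism_comp[OF stone_map_CA_isomorphism, unfolded canonical_CS_def,
        OF closure_of_CA_isomorphism[OF topological_pair_canonical_CS]]
    by (simp add: canonical_CS_def)
qed

lemma two_contact_space_canonical_CS: "two_contact_space (canonical_CS B)"
  unfolding canonical_CS_def two_contact_space_def prod.case
proof (intro conjI ballI)
  show "topological_pair (clan_topology B, Ult B)" by (rule topological_pair_canonical_CS)
  show "t0_space (clan_topology B)"
    unfolding t0_space topspace_clan_topology
  proof (intro ballI impI)
    fix \<Gamma> \<Delta> assume C: "\<Gamma> \<in> Clans B" "\<Delta> \<in> Clans B" and "\<Gamma> \<noteq> \<Delta>"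
    then obtain a where a: "a \<in> carrier B" "a \<in> \<Gamma> \<longleftrightarrow> a \<notin> \<Delta>"
      using Clan_subset by blast
    then have "closedin (clan_topology B) (clan_map B a)"
      using closed_base_clan_topology by (simp add: closed_base_def)
    moreover have "\<Gamma> \<notin> clan_map B a \<longleftrightarrow> \<Delta> \<in> clan_map B a"
      using C a by (simp add: clan_map_def)
    ultimately show "\<exists>F. closedin (clan_topology B) F \<and> (\<Gamma> \<notin> F \<longleftrightarrow> \<Delta> \<in> F)" by blast
  qed
  show "Stone_space stone_top" by (rule Stone_space_stone_top)
  show "closed_base (clan_topology B) (RC_pair (clan_topology B, Ult B))"
    using closed_base_clan_topology iso_image[OF clan_map_CA_isomorphism]
    by (simp add: canonical_CS_def)
  fix \<Delta> assume "\<Delta> \<in> Clans (clopen_CA (clan_topology B, Ult B))"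
  moreover have "(`) stone_map ` Clans B = Clans (clopen_CA (clan_topology B, Ult B))"
    using bij_betw_imp_surj_on[OF bij_betw_Clans[OF contact_algebra_axioms stone_map_CA_isomorphism]]
    by (simp add: canonical_CS_def)
  ultimately obtain \<Gamma> where G: "\<Gamma> \<in> Clans B" "\<Delta> = stone_map ` \<Gamma>"
    by (metis imageE)
  \<comment> \<open>Condition (CS4): a clan of the clopen algebra is the Stone image of a clan
    \<Gamma> of \<open>B\<close>, and the point realizing it is \<Gamma> itself.\<close>
  have "point_clan (clan_topology B, Ult B) \<Gamma> = stone_map ` \<Gamma>"
    using G(1) Clan_subset[OF G(1)]
    by (auto simp: point_clan_def CO_stone_top closure_of_stone_map clan_map_def)
  then show "\<exists>\<Gamma>\<in>topspace (clan_topology B). \<Delta> = point_clan (clan_topology B, Ult B) \<Gamma>"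
    using G by (auto simp: topspace_clan_topology)
qed

end

section \<open>Isomorphic 2-contact spaces, connectedness and completeness\<close>

lemma two_contact_spaceD:
  assumes "two_contact_space (X, S)"
  shows "topological_pair (X, S)" "t0_space X" "compact_space (subtopology X S)"
    "closed_base X (RC_pair (X, S))"
    "\<Gamma> \<in> Clans (clopen_CA (X, S)) \<Longrightarrow> \<exists>x\<in>topspace X. \<Gamma> = point_clan (X, S) x"
  using assms by (simp_all add: two_contact_space_def Stone_space_def)

text \<open>The points of \<open>canonical_CS (canonical_CA P)\<close> are clans of regular closed
  sets, whereas (CS4) concerns clans of clopen subsets of \<open>X\<^sub>0\<close>. This is
  \<open>point_clan\<close> carried across the closure isomorphism.\<close>

definition RC_clan :: "'a top_pair \<Rightarrow> 'a \<Rightarrow> 'a set set"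
  where "RC_clan P x = {F \<in> RC_pair P. x \<in> F}"

lemma RC_clan_eq_image: "RC_clan (X, S) x = (\<lambda>A. X closure_of A) ` point_clan (X, S) x"
  by (auto simp: RC_clan_def RC_pair_eq point_clan_def)

lemma RC_clan_in_Clans:
  assumes P: "topological_pair (X, S)" and x: "x \<in> topspace X"
  shows "RC_clan (X, S) x \<in> Clans (canonical_CA (X, S))"
proof -
  interpret contact_algebra "canonical_CA (X, S)" using P by (rule contact_algebra_canonical_CA)
  show ?thesis
    by (rule ClansI) (use x one_closed in \<open>auto simp: RC_clan_def\<close>)
qed

lemma
  assumes P: "two_contact_space (X, S)"
  shows RC_clan_homeomorphic_map:
      "homeomorphic_map X (clan_topology (canonical_CA (X, S))) (RC_clan (X, S))"
    and RC_clan_image: "RC_clan (X, S) ` S = Ult (canonical_CA (X, S))"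
proof -
  let ?A = "canonical_CA (X, S)" and ?h = "RC_clan (X, S)"
  note D = two_contact_spaceD[OF P]
  have cA: "contact_algebra (clopen_CA (X, S))" using D(1) by (rule contact_algebra_clopen_CA)
  interpret contact_algebra ?A using D(1) by (rule contact_algebra_canonical_CA)
  note iso = closure_of_CA_isomorphism[OF D(1)]
  have inj: "inj_on ?h (topspace X)"
  proof (rule inj_onI, rule ccontr)
    fix x y assume xy: "x \<in> topspace X" "y \<in> topspace X" "?h x = ?h y" "x \<noteq> y"
    then obtain C where C: "closedin X C" "x \<notin> C \<longleftrightarrow> y \<in> C"
      using D(2) unfolding t0_space by blast
    obtain \<G> where \<G>: "\<G> \<subseteq> RC_pair (X, S)" "C = topspace X \<inter> \<Inter>\<G>"
      using D(4) C(1) unfolding closed_base_def by blast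
    have "x \<in> F \<longleftrightarrow> y \<in> F" if "F \<in> \<G>" for F
      using that xy(3) \<G>(1) by (auto simp: RC_clan_def)
    then show False using C(2) xy(1,2) unfolding \<G>(2) by blast
  qed
  have surj: "?h ` topspace X = Clans ?A"
  proof
    show "?h ` topspace X \<subseteq> Clans ?A" using RC_clan_in_Clans[OF D(1)] by blast
    show "Clans ?A \<subseteq> ?h ` topspace X"
    proof
      fix \<Gamma> assume "\<Gamma> \<in> Clans ?A"
      then obtain \<Delta> where "\<Delta> \<in> Clans (clopen_CA (X, S))" "\<Gamma> = (\<lambda>A. X closure_of A) ` \<Delta>"
        using bij_betw_imp_surj_on[OF bij_betw_Clans[OF cA iso]] by (metis imageE)
      then show "\<Gamma> \<in> ?h ` topspace X"
        using D(5)[of \<Delta>] by (auto simp: RC_clan_eq_image)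
    qed
  qed
  \<comment> \<open>By surjectivity every clan containing \<open>F\<close> is the clan of some
    point, and that point lies in \<open>F\<close>; so basic closed sets go exactly onto basic
    closed sets.\<close>
  have im: "?h ` F = clan_map ?A F" if F: "F \<in> RC_pair (X, S)" for F
  proof
    have sub: "F \<subseteq> topspace X" 
      using F by (auto simp: RC_pair_eq dest: subsetD[OF closure_of_subset_topspace])
    then show "?h ` F \<subseteq> clan_map ?A F"
      using F surj by (auto simp: clan_map_def RC_clan_def)
    show "clan_map ?A F \<subseteq> ?h ` F"
      unfolding clan_map_def surj[symmetric] by (auto simp: RC_clan_def)
  qed
  show "homeomorphic_map X (clan_topology ?A) ?h"
  proof (rule homeomorphic_map_closed_base)
    show "bij_betw ?h (topspace X) (topspace (clan_topology ?A))"
      using inj surj by (simp add: bij_betw_def topspace_clan_topology)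
    show "closed_base X (RC_pair (X, S))" by (rule D(4))
    show "closed_base (clan_topology ?A) (clan_map ?A ` carrier ?A)"
      by (rule closed_base_clan_topology)
    show "(`) ?h ` RC_pair (X, S) = clan_map ?A ` carrier ?A"
      using im by (simp cong: image_cong)
  qed
  \<comment> \<open>Ultrafilters of \<open>RC(X,X\<^sub>0)\<close> are images of ultrafilters of
    clopen sets, which compactness of \<open>S\<close> identifies with the points of
    \<open>S\<close>.\<close>
  have "Ult ?A = (`) (\<lambda>A. X closure_of A) ` point_clan (X, S) ` S"
    using iso_image_Ults[OF cA iso] Ult_clopen_CA[OF D(1,3)] by simp
  then show "?h ` S = Ult ?A" by (simp add: image_image RC_clan_eq_image)
qed

lemma CS_isomorphic_trans:
  assumes "CS_isomorphic P Q" "CS_isomorphic Q R"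
  shows "CS_isomorphic P R"
proof (cases P; cases Q; cases R)
  fix X S Y T Z U assume eq: "P = (X, S)" "Q = (Y, T)" "R = (Z, U)"
  then obtain f g where "homeomorphic_map X Y f" "f ` S = T" "homeomorphic_map Y Z g" "g ` T = U"
    using assms by (auto simp: CS_isomorphic_def)
  then have "homeomorphic_map X Z (g \<circ> f)" "(g \<circ> f) ` S = U"
    using homeomorphic_map_compose by (blast, auto)
  then show ?thesis unfolding eq CS_isomorphic_def by auto
qed

lemma CS_isomorphic_sym:
  assumes P: "topological_pair P" and iso: "CS_isomorphic P Q"
  shows "CS_isomorphic Q P"
proof (cases P; cases Q)
  fix X S Y T assume eq: "P = (X, S)" "Q = (Y, T)"
  then obtain f where f: "homeomorphic_map X Y f" "f ` S = T"
    using iso by (auto simp: CS_isomorphic_def)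
  obtain g where "homeomorphic_maps X Y f g" using f(1) homeomorphic_map_maps by blast
  then have g: "homeomorphic_map Y X g" "\<And>x. x \<in> topspace X \<Longrightarrow> g (f x) = x"
    by (simp_all add: homeomorphic_maps_map)
  \<comment> \<open>The map \<open>g\<close> inverts \<open>f\<close> only on the space, so
    \<open>S\<close> has to lie inside it.\<close>
  have "S \<subseteq> topspace X" using P unfolding eq by (rule topological_pairD(1))
  then have "(\<lambda>x. g (f x)) ` S = (\<lambda>x. x) ` S" using g(2) by (intro image_cong) auto
  then have "g ` T = S" by (simp add: f(2)[symmetric] image_image)
  with g(1) show ?thesis unfolding eq CS_isomorphic_def by auto
qed

lemma two_contact_space_topological_pair: "two_contact_space P \<Longrightarrow> topological_pair P"
  using two_contact_spaceD(1) by (cases P) blast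

lemma two_contact_space_contact_algebra: "two_contact_space P \<Longrightarrow> contact_algebra (canonical_CA P)"
  using two_contact_spaceD(1) contact_algebra_canonical_CA by (cases P) blast

lemma CS_isomorphic_canonical_CS_canonical_CA:
  assumes P: "two_contact_space P"
  shows "CS_isomorphic P (canonical_CS (canonical_CA P))"
proof (cases P)
  case (Pair X S)
  then show ?thesis
    using RC_clan_homeomorphic_map[of X S] RC_clan_image[of X S] P
    by (auto simp: CS_isomorphic_def canonical_CS_def)
qed

text \<open>Direct image along \<phi> is a bijection of clans that takes the clans through
  \<open>a\<close> to those through \<phi>(\<open>a\<close>), hence one closed base onto the
  other.\<close>

lemma CS_isomorphic_canonical_CS:
  assumes A: "contact_algebra A" and iso: "CA_isomorphic A B"
  shows "CS_isomorphic (canonical_CS A) (canonical_CS B)"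
proof -
  obtain \<phi> where \<phi>: "CA_isomorphism \<phi> A B" using iso by (auto simp: CA_isomorphic_def)
  interpret A: contact_algebra A by (rule A)
  interpret B: contact_algebra B using A \<phi> by (rule CA_isomorphism_contact_algebra)
  note bij = bij_betw_Clans[OF A \<phi>]
  have mem: "\<phi> a \<in> \<phi> ` \<Gamma> \<longleftrightarrow> a \<in> \<Gamma>" if "\<Gamma> \<in> Clans A" "a \<in> carrier A" for \<Gamma> a
    using inj_on_image_mem_iff[OF bij_betw_imp_inj_on[OF iso_bij[OF \<phi>]] that(2) A.Clan_subset[OF that(1)]] .
  have im: "(`) \<phi> ` clan_map A a = clan_map B (\<phi> a)" if a: "a \<in> carrier A" for a
    unfolding clan_map_def bij_betw_imp_surj_on[OF bij, symmetric] using mem a by auto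
  have "homeomorphic_map (clan_topology A) (clan_topology B) ((`) \<phi>)"
  proof (rule homeomorphic_map_closed_base)
    show "bij_betw ((`) \<phi>) (topspace (clan_topology A)) (topspace (clan_topology B))"
      using bij by (simp add: A.topspace_clan_topology B.topspace_clan_topology)
    show "(`) ((`) \<phi>) ` clan_map A ` carrier A = clan_map B ` carrier B"
      unfolding iso_image[OF \<phi>, symmetric] image_image using im by (simp cong: image_cong)
  qed (rule A.closed_base_clan_topology B.closed_base_clan_topology)+
  then show ?thesis
    using iso_image_Ults[OF A \<phi>] by (auto simp: CS_isomorphic_def canonical_CS_def)
qed

text \<open>A homeomorphism restricts to the dense subspaces and commutes with closure, so direct
  image preserves clopen sets and contact. The statement for regular closed algebras follows by
  composing with closure isomorphisms.\<close>

lemma CA_isomorphic_clopen_CA: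
  assumes P: "topological_pair (X, S)" and iso: "CS_isomorphic (X, S) (Y, T)"
  shows "CA_isomorphic (clopen_CA (X, S)) (clopen_CA (Y, T))"
proof -
  obtain f where f: "homeomorphic_map X Y f" "f ` S = T"
    using iso by (auto simp: CS_isomorphic_def)
  note S = topological_pairD(1)[OF P]
  have inj: "inj_on f (topspace X)" and surj: "f ` topspace X = topspace Y"
    using f(1) by (simp_all add: homeomorphic_imp_injective_map homeomorphic_imp_surjective_map)
  have T: "T \<subseteq> topspace Y" using S f(2) surj by blast
  have hom: "homeomorphic_map (subtopology X S) (subtopology Y T) f"
    using f(1) S T f(2) by (intro homeomorphic_map_subtopologies) (auto simp: Int_absorb1)
  have sub: "A \<subseteq> topspace X" if "A \<in> CO (subtopology X S)" for A
    using CO_subset[OF S that] S by blast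
  have CO: "A \<in> CO (subtopology X S) \<longleftrightarrow> f ` A \<in> CO (subtopology Y T)" if "A \<subseteq> S" for A
    using homeomorphic_map_openness[OF hom, of A] homeomorphic_map_closedness[OF hom, of A] that S
    by (auto simp: CO_def)
  have "CA_isomorphism ((`) f) (clopen_CA (X, S)) (clopen_CA (Y, T))"
  proof (rule CA_isomorphismI; simp?)
    have "(`) f ` CO (subtopology X S) = CO (subtopology Y T)"
    proof
      show "(`) f ` CO (subtopology X S) \<subseteq> CO (subtopology Y T)"
        using CO CO_subset[OF S] by blast
      show "CO (subtopology Y T) \<subseteq> (`) f ` CO (subtopology X S)"
      proof
        fix A' assume A': "A' \<in> CO (subtopology Y T)"
        then obtain A where A: "A \<subseteq> S" "A' = f ` A"
          using CO_subset[OF T A'] f(2) by (metis subset_image_iff)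
        then show "A' \<in> (`) f ` CO (subtopology X S)" using CO[OF A(1)] A' by blast
      qed
    qed
    then show "bij_betw ((`) f) (CO (subtopology X S)) (CO (subtopology Y T))"
      using inj_on_image_eq_iff[OF inj] sub by (auto simp: bij_betw_def intro!: inj_onI)
    show "f ` S = T" by (rule f(2))
    show "f ` (A \<union> A') = f ` A \<union> f ` A'" for A A' by (rule image_Un)
    show "f ` (S - A) = T - f ` A" if "A \<in> CO (subtopology X S)" for A
      using inj_on_image_set_diff[OF inj, of S A] S sub[OF that] f(2) by auto
    fix A A' assume A: "A \<in> CO (subtopology X S)" "A' \<in> CO (subtopology X S)"
    show "f ` (A \<inter> A') = f ` A \<inter> f ` A'"
      using inj_on_image_Int[OF inj sub[OF A(1)] sub[OF A(2)]] .
    have "f ` (X closure_of A \<inter> X closure_of A') = Y closure_of (f ` A) \<inter> Y closure_of (f ` A')"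
      using inj_on_image_Int[OF inj closure_of_subset_topspace closure_of_subset_topspace]
        homeomorphic_map_closure_of[OF f(1) sub[OF A(1)]]
        homeomorphic_map_closure_of[OF f(1) sub[OF A(2)]] by simp
    then show "(X closure_of A \<inter> X closure_of A' = {}) = (Y closure_of (f ` A) \<inter> Y closure_of (f ` A') = {})"
      by (metis image_is_empty)
  qed
  then show ?thesis by (auto simp: CA_isomorphic_def)
qed

lemma CA_isomorphic_canonical_CA:
  assumes P: "topological_pair P" and Q: "topological_pair Q" and iso: "CS_isomorphic P Q"
  shows "CA_isomorphic (canonical_CA P) (canonical_CA Q)"
proof (cases P; cases Q)
  fix X S Y T assume eq: "P = (X, S)" "Q = (Y, T)"
  \<comment> \<open>The separate type variable keeps this fact polymorphic, since the two pairs may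
    have different point types.\<close>
  have *: "CA_isomorphic (clopen_CA (Z, U)) (canonical_CA (Z, U))"
    if "topological_pair (Z, U)" for Z :: "'z topology" and U
    using closure_of_CA_isomorphism[OF that] by (auto simp: CA_isomorphic_def)
  show ?thesis
    using P Q iso unfolding eq
    by (meson * CA_isomorphic_clopen_CA CA_isomorphic_sym CA_isomorphic_trans contact_algebra_clopen_CA)
qed

section \<open>Connectedness of contact algebras and of spaces\<close>

lemma ca_connected_iso:
  assumes A: "contact_algebra A" and iso: "CA_isomorphic A B" and con: "ca_connected A"
  shows "ca_connected B"
  unfolding ca_connected_def
proof (intro ballI impI, elim conjE)
  obtain \<phi> where \<phi>: "CA_isomorphism \<phi> A B" using iso by (auto simp: CA_isomorphic_def)
  interpret A: contact_algebra A by (rule A)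
  fix b assume "b \<in> carrier B" "b \<noteq> \<^bold>0\<^bsub>B\<^esub>" "b \<noteq> \<^bold>1\<^bsub>B\<^esub>"
  moreover from this obtain a where a: "a \<in> carrier A" "b = \<phi> a" using iso_image[OF \<phi>] by blast
  ultimately have "a \<noteq> \<^bold>0\<^bsub>A\<^esub>" "a \<noteq> \<^bold>1\<^bsub>A\<^esub>" using iso_zero[OF \<phi>] iso_one[OF \<phi>] by auto
  then have "contact A a (\<^bold>-\<^bsub>A\<^esub> a)" using con a(1) by (simp add: ca_connected_def)
  then show "contact B b (\<^bold>-\<^bsub>B\<^esub> b)"
    using iso_contact[OF \<phi> a(1) A.compl_closed[OF a(1)]] iso_compl[OF \<phi> a(1)] a(2) by simp
qed

text \<open>By density \<open>V\<close> is the closure of its trace on \<open>S\<close>, and this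
  trace is clopen in \<open>S\<close>.\<close>

lemma clopen_in_RC_pair:
  assumes P: "topological_pair (X, S)" and V: "openin X V" "closedin X V"
  shows "V \<in> RC_pair (X, S)"
proof -
  note S = topological_pairD[OF P]
  have "V \<inter> S \<in> CO (subtopology X S)"
    using V by (auto simp: CO_def openin_subtopology closedin_subtopology)
  moreover have "X closure_of (V \<inter> S) = X closure_of V"
    using V S(2) openin_subset[of X V] by (intro closure_of_openin_Int_superset) simp
  ultimately show ?thesis using V(2) by (metis RC_pair_eq closure_of_closedin image_eqI)
qed

text \<open>If F misses the closure of its set complement, that complement is closed, so F is
  clopen. Conversely, the complement of a clopen set is already closed and disjoint from it, so a
  proper nonempty clopen set refutes contact with the complement.\<close>

lemma CS_connected_iff:
  assumes P: "topological_pair P"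
  shows "CS_connected P \<longleftrightarrow> ca_connected (canonical_CA P)"
proof (cases P)
  case (Pair X S)
  note P = P[unfolded Pair]
  have "connected_space X \<longleftrightarrow> ca_connected (canonical_CA (X, S))"
  proof
    assume con: "connected_space X"
    have "F \<inter> (X closure_of (topspace X - F)) \<noteq> {}"
      if F: "F \<in> RC_pair (X, S)" "F \<noteq> {}" "F \<noteq> topspace X" for F
    proof
      assume dis: "F \<inter> (X closure_of (topspace X - F)) = {}"
      have cl: "closedin X F" using F(1) by (auto simp: RC_pair_eq)
      have "topspace X - F \<subseteq> X closure_of (topspace X - F)" by (simp add: closure_of_subset)
      with dis have "topspace X - F = X closure_of (topspace X - F)"
        using closure_of_subset_topspace[of X "topspace X - F"] by blast
      then have "openin X F"
        using cl by (metis closedin_closure_of closedin_subset openin_closedin)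
      then show False using con cl F(2,3) by (auto simp: connected_space_clopen_in)
    qed
    then show "ca_connected (canonical_CA (X, S))" by (simp add: ca_connected_def)
  next
    assume con: "ca_connected (canonical_CA (X, S))"
    have "V = {} \<or> V = topspace X" if V: "openin X V" "closedin X V" for V
    proof (rule ccontr)
      assume "\<not> ?thesis"
      moreover have "X closure_of (topspace X - V) = topspace X - V"
        using V(1) by (simp add: closure_of_closedin closedin_diff)
      ultimately show False
        using con clopen_in_RC_pair[OF P V] by (auto simp: ca_connected_def)
    qed
    then show "connected_space X" by (simp add: connected_space_clopen_in)
  qed
  then show ?thesis by (simp add: Pair CS_connected_def)
qed

section \<open>Completeness and regular closed sets\<close>

lemma (in bool_alg) ba_complete_iff:
  "ba_complete B \<longleftrightarrow> (\<forall>A\<subseteq>carrier B. \<exists>s\<in>carrier B. (\<forall>x\<in>A. ble B x s) \<and>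
     (\<forall>u\<in>carrier B. (\<forall>x\<in>A. ble B x u) \<longrightarrow> ble B s u))"
proof -
  let ?L = "ba_order B"
  have simps [simp]: "carrier ?L = carrier B" "le ?L = ble B" "eq ?L = (=)"
    by (simp_all add: ba_order_def)
  interpret partial_order ?L
    by unfold_locales (auto intro: ble_refl ble_antisym elim: ble_trans)
  have Upper: "Upper ?L A = {u \<in> carrier B. \<forall>x\<in>A. ble B x u}"
    and Lower: "Lower ?L A = {l \<in> carrier B. \<forall>x\<in>A. ble B l x}" if "A \<subseteq> carrier B" for A
    using that by (auto simp: Upper_def Lower_def)
  show ?thesis
  proof
    assume "ba_complete B"
    then interpret complete_lattice ?L by (simp add: ba_complete_def)
    show "\<forall>A\<subseteq>carrier B. \<exists>s\<in>carrier B. (\<forall>x\<in>A. ble B x s) \<and>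
        (\<forall>u\<in>carrier B. (\<forall>x\<in>A. ble B x u) \<longrightarrow> ble B s u)"
    proof (intro allI impI)
      fix A assume A: "A \<subseteq> carrier B"
      then obtain s where "least ?L s (Upper ?L A)" using sup_exists by auto
      then show "\<exists>s\<in>carrier B. (\<forall>x\<in>A. ble B x s) \<and>
          (\<forall>u\<in>carrier B. (\<forall>x\<in>A. ble B x u) \<longrightarrow> ble B s u)"
        by (auto simp: least_def Upper[OF A])
    qed
  next
    assume sup: "\<forall>A\<subseteq>carrier B. \<exists>s\<in>carrier B. (\<forall>x\<in>A. ble B x s) \<and>
        (\<forall>u\<in>carrier B. (\<forall>x\<in>A. ble B x u) \<longrightarrow> ble B s u)"
    have "complete_lattice ?L"
    proof (rule complete_latticeI)
      fix A assume "A \<subseteq> carrier ?L"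
      then have A: "A \<subseteq> carrier B" by simp
      obtain s where "s \<in> carrier B" "\<forall>x\<in>A. ble B x s"
        "\<forall>u\<in>carrier B. (\<forall>x\<in>A. ble B x u) \<longrightarrow> ble B s u"
        using sup[rule_format, OF A] by blast
      then show "\<exists>s. least ?L s (Upper ?L A)"
        by (auto simp: least_def Upper[OF A] intro!: exI[of _ s])
      \<comment> \<open>\<open>complete_lattice\<close> also asks for infima; the infimum is the
        supremum of the lower bounds.\<close>
      let ?A' = "{l \<in> carrier B. \<forall>x\<in>A. ble B l x}"
      obtain i where "i \<in> carrier B" "\<forall>x\<in>?A'. ble B x i"
        "\<forall>u\<in>carrier B. (\<forall>x\<in>?A'. ble B x u) \<longrightarrow> ble B i u"
        using sup[rule_format, of ?A'] by auto
      moreover from this have "\<forall>x\<in>A. ble B i x" using A by auto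
      ultimately show "\<exists>i. greatest ?L i (Lower ?L A)"
        by (auto simp: greatest_def Lower[OF A] intro!: exI[of _ i])
    qed
    then show "ba_complete B" by (simp add: ba_complete_def)
  qed
qed

lemma ba_complete_iso:
  assumes A: "contact_algebra A" and iso: "CA_isomorphic A B" and com: "ba_complete A"
  shows "ba_complete B"
proof -
  obtain \<phi> where \<phi>: "CA_isomorphism \<phi> A B" using iso by (auto simp: CA_isomorphic_def)
  interpret A: contact_algebra A by (rule A)
  interpret B: contact_algebra B using A \<phi> by (rule CA_isomorphism_contact_algebra)
  have im: "carrier B = \<phi> ` carrier A" using iso_image[OF \<phi>] by simp
  show ?thesis
    unfolding B.ba_complete_iff
  proof (intro allI impI)
    fix D' assume "D' \<subseteq> carrier B"
    then obtain D where D: "D \<subseteq> carrier A" "D' = \<phi> ` D" unfolding im by (metis subset_image_iff)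
    obtain s where s: "s \<in> carrier A" "\<forall>x\<in>D. ble A x s"
      "\<forall>u\<in>carrier A. (\<forall>x\<in>D. ble A x u) \<longrightarrow> ble A s u"
      using com D(1) unfolding A.ba_complete_iff by blast
    have le: "ble B (\<phi> x) (\<phi> u) \<longleftrightarrow> ble A x u" if "x \<in> D" "u \<in> carrier A" for x u
      using iso_ble[OF A \<phi>] that D(1) by blast
    show "\<exists>s\<in>carrier B. (\<forall>x\<in>D'. ble B x s) \<and> (\<forall>u\<in>carrier B. (\<forall>x\<in>D'. ble B x u) \<longrightarrow> ble B s u)"
    proof (intro bexI conjI)
      show "\<phi> s \<in> carrier B" using s(1) im by simp
      show "\<forall>x\<in>D'. ble B x (\<phi> s)" using s(1,2) le D(2) by simp
      show "\<forall>u\<in>carrier B. (\<forall>x\<in>D'. ble B x u) \<longrightarrow> ble B (\<phi> s) u"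
        using s(1,3) iso_ble[OF A \<phi> s(1)] by (simp add: im D(2) le)
    qed
  qed
qed

lemma closure_of_open_in_RC:
  assumes "openin X V"
  shows "X closure_of V \<in> RC X"
proof -
  have "V \<subseteq> X interior_of (X closure_of V)"
    using assms by (simp add: interior_of_maximal closure_of_subset openin_subset)
  then have "X closure_of V \<subseteq> X closure_of (X interior_of (X closure_of V))"
    by (rule closure_of_mono)
  moreover have "X closure_of (X interior_of (X closure_of V)) \<subseteq> X closure_of V"
    by (simp add: closure_of_minimal interior_of_subset)
  ultimately show ?thesis by (simp add: RC_def closure_of_subset_topspace)
qed

lemma RC_pair_subset_RC:
  assumes P: "topological_pair (X, S)"
  shows "RC_pair (X, S) \<subseteq> RC X"
proof
  fix F assume "F \<in> RC_pair (X, S)"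
  then obtain A where A: "A \<in> CO (subtopology X S)" "F = X closure_of A" by (auto simp: RC_pair_eq)
  then obtain V where V: "openin X V" "A = V \<inter> S" by (auto simp: CO_def openin_subtopology)
  have "F = X closure_of V"
    unfolding A(2) V(2) using V(1) topological_pairD(2)[OF P] openin_subset[of X V]
    by (intro closure_of_openin_Int_superset) simp
  then show "F \<in> RC X" using closure_of_open_in_RC[OF V(1)] by simp
qed

text \<open>By (CS3) a point of \<open>W\<close> is separated from the complement of
  \<open>W\<close> by a member F of the base. The set outside F lies in \<open>W\<close>, and its
  closure is the algebraic complement of F.\<close>

lemma RC_pair_dense:
  assumes P: "topological_pair (X, S)" and base: "closed_base X (RC_pair (X, S))"
    and W: "openin X W" "W \<noteq> {}"
  obtains V where "openin X V" "V \<noteq> {}" "V \<subseteq> W" "X closure_of V \<in> RC_pair (X, S)"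
proof -
  interpret contact_algebra "canonical_CA (X, S)" using P by (rule contact_algebra_canonical_CA)
  obtain x where x: "x \<in> W" "x \<in> topspace X" using W openin_subset by blast
  have "closedin X (topspace X - W)" using W(1) by blast
  then obtain \<G> where \<G>: "\<G> \<subseteq> RC_pair (X, S)" "topspace X - W = topspace X \<inter> \<Inter>\<G>"
    using base unfolding closed_base_def by blast
  then obtain F where F: "F \<in> \<G>" "x \<notin> F" using x by blast
  then have FR: "F \<in> RC_pair (X, S)" using \<G>(1) by blast
  show thesis
  proof (rule that)
    show "openin X (topspace X - F)" using FR by (auto simp: RC_pair_eq)
    show "topspace X - F \<noteq> {}" using x F by blast
    show "topspace X - F \<subseteq> W" using \<G>(2) F(1) by blast
    show "X closure_of (topspace X - F) \<in> RC_pair (X, S)" using compl_closed[of F] FR by simp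
  qed
qed

text \<open>Since \<open>RC(X,X\<^sub>0)\<close> is dense in \<open>RC(X)\<close>, every \<open>G\<close> in \<open>RC(X)\<close> is the supremum in \<open>RC(X,X\<^sub>0)\<close>
  of the elements below \<open>G\<close>, as soon as this supremum exists.\<close>

lemma RC_pair_eq_RC_iff:
  assumes P: "topological_pair (X, S)" and base: "closed_base X (RC_pair (X, S))"
  shows "RC_pair (X, S) = RC X \<longleftrightarrow> ba_complete (canonical_CA (X, S))"
proof -
  interpret contact_algebra "canonical_CA (X, S)" using P by (rule contact_algebra_canonical_CA)
  have reg: "F = X closure_of (X interior_of F)" if "F \<in> RC X" for F
    using that by (simp add: RC_def)
  then have closed: "closedin X F" if "F \<in> RC X" for F
    using that by (metis closedin_closure_of)
  show ?thesis
  proof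
    assume eq: "RC_pair (X, S) = RC X"
    have "\<exists>s\<in>RC X. (\<forall>F\<in>\<F>. F \<subseteq> s) \<and> (\<forall>u\<in>RC X. (\<forall>F\<in>\<F>. F \<subseteq> u) \<longrightarrow> s \<subseteq> u)" if \<F>: "\<F> \<subseteq> RC X" for \<F>
    proof (intro bexI conjI ballI impI)
      \<comment> \<open>Suprema in \<open>RC(X)\<close> are closures of unions of interiors, since
        an arbitrary union of regular closed sets may fail to be closed.\<close>
      let ?V = "\<Union>F\<in>\<F>. X interior_of F"
      show "X closure_of ?V \<in> RC X" by (intro closure_of_open_in_RC openin_Union) auto
      show "F \<subseteq> X closure_of ?V" if "F \<in> \<F>" for F
      proof -
        have "F = X closure_of (X interior_of F)" using that \<F> reg by blast
        also have "\<dots> \<subseteq> X closure_of ?V" using that by (intro closure_of_mono) blast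
        finally show ?thesis .
      qed
      show "X closure_of ?V \<subseteq> u" if "u \<in> RC X" "\<forall>F\<in>\<F>. F \<subseteq> u" for u
      proof (rule closure_of_minimal)
        show "?V \<subseteq> u" using that(2) interior_of_subset[of X] by blast
      qed (rule closed[OF that(1)])
    qed
    then show "ba_complete (canonical_CA (X, S))"
      unfolding ba_complete_iff by (simp add: eq)
  next
    assume com: "ba_complete (canonical_CA (X, S))"
    have "G \<in> RC_pair (X, S)" if G: "G \<in> RC X" for G
    proof -
      let ?\<F> = "{F \<in> RC_pair (X, S). F \<subseteq> G}"
      have "?\<F> \<subseteq> carrier (canonical_CA (X, S))" by auto
      then obtain s where s: "s \<in> RC_pair (X, S)" "\<And>F. F \<in> ?\<F> \<Longrightarrow> F \<subseteq> s"
        "\<And>u. \<lbrakk>u \<in> RC_pair (X, S); \<And>F. F \<in> ?\<F> \<Longrightarrow> F \<subseteq> u\<rbrakk> \<Longrightarrow> s \<subseteq> u"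
        using com unfolding ba_complete_iff ble_sets canonical_CA_simps by meson
      have sRC: "s \<in> RC X" using s(1) RC_pair_subset_RC[OF P] by blast
      note cl = closed[OF G] closed[OF sRC]
      \<comment> \<open>Otherwise density gives a nonempty open \<open>V\<close> inside
        \<open>G\<close> and outside \<open>s\<close> whose closure belongs to the family bounded by
        \<open>s\<close>.\<close>
      have "X interior_of G \<subseteq> s"
      proof (rule ccontr)
        assume "\<not> ?thesis"
        then obtain V where V: "openin X V" "V \<noteq> {}" "V \<subseteq> X interior_of G - s"
          "X closure_of V \<in> RC_pair (X, S)"
          using RC_pair_dense[OF P base, of "X interior_of G - s"] cl(2)
          by (metis Diff_eq_empty_iff openin_diff openin_interior_of)
        have "V \<subseteq> G" using V(3) interior_of_subset[of X G] by blast
        then have "X closure_of V \<subseteq> s" using s(2) V(4) closure_of_minimal[OF _ cl(1)] by simp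
        then have "V \<subseteq> s" using closure_of_subset[OF openin_subset[OF V(1)]] by blast
        then show False using V(2,3) by blast
      qed
      then have "G \<subseteq> s" using closure_of_minimal[OF _ cl(2)] reg[OF G] by metis
      moreover have "X interior_of s \<subseteq> G"
      proof (rule ccontr)
        assume "\<not> ?thesis"
        then obtain V where V: "openin X V" "V \<noteq> {}" "V \<subseteq> X interior_of s - G"
          "X closure_of V \<in> RC_pair (X, S)"
          using RC_pair_dense[OF P base, of "X interior_of s - G"] cl(1)
          by (metis Diff_eq_empty_iff openin_diff openin_interior_of)
        \<comment> \<open>The complement of the closure of \<open>V\<close> is an upper bound of the
          family, because members of the family lie in \<open>G\<close> and so avoid
          \<open>V\<close>. It would thus contain \<open>s\<close> and with it \<open>V\<close>,
          from which it is disjoint.\<close>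
        let ?K = "X closure_of (topspace X - X closure_of V)"
        have "s \<subseteq> ?K"
        proof (rule s(3))
          show "?K \<in> RC_pair (X, S)" using compl_closed[of "X closure_of V"] V(4) by simp
          fix F assume F: "F \<in> ?\<F>"
          then have FRC: "F \<in> RC X" using RC_pair_subset_RC[OF P] by blast
          have "X interior_of F \<inter> V = {}" using F V(3) interior_of_subset[of X F] by blast
          then have "X interior_of F \<inter> X closure_of V = {}"
            by (simp add: openin_Int_closure_of_eq_empty)
          then have "X interior_of F \<subseteq> topspace X - X closure_of V"
            using interior_of_subset_topspace[of X F] by blast
          then show "F \<subseteq> ?K" using closure_of_mono reg[OF FRC] by metis
        qed
        moreover have "V \<subseteq> s" using V(3) interior_of_subset[of X s] by blast
        moreover have "V \<inter> (topspace X - X closure_of V) = {}"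
          using closure_of_subset[OF openin_subset[OF V(1)]] by blast
        then have "V \<inter> ?K = {}" using openin_Int_closure_of_eq_empty[OF V(1)] by blast
        ultimately show False using V(2) by blast
      qed
      then have "s \<subseteq> G" using closure_of_minimal[OF _ cl(1)] reg[OF sRC] by metis
      ultimately show ?thesis using s(1) by simp
    qed
    then show "RC_pair (X, S) = RC X" using RC_pair_subset_RC[OF P] by blast
  qed
qed

text \<open>One direction is functoriality. For the other, passing to the canonical algebras of the
  two spaces returns copies of \<open>A\<close> and \<open>B\<close> through
  \<open>clan_map\<close>.\<close>

lemma CS_isomorphic_canonical_CS_iff:
  assumes A: "contact_algebra A" and B: "contact_algebra B"
  shows "CA_isomorphic A B \<longleftrightarrow> CS_isomorphic (canonical_CS A) (canonical_CS B)"
proof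
  interpret A: contact_algebra A by (rule A)
  interpret B: contact_algebra B by (rule B)
  assume "CS_isomorphic (canonical_CS A) (canonical_CS B)"
  then have "CA_isomorphic (canonical_CA (canonical_CS A)) (canonical_CA (canonical_CS B))"
    by (intro CA_isomorphic_canonical_CA)
      (simp_all add: canonical_CS_def A.topological_pair_canonical_CS B.topological_pair_canonical_CS)
  moreover have "CA_isomorphic A (canonical_CA (canonical_CS A))"
    using A.clan_map_CA_isomorphism by (auto simp: CA_isomorphic_def)
  moreover have "CA_isomorphic (canonical_CA (canonical_CS B)) B"
    using B.clan_map_CA_isomorphism CA_isomorphic_sym[OF B] by (auto simp: CA_isomorphic_def)
  ultimately show "CA_isomorphic A B" by (meson CA_isomorphic_trans)
qed (rule CS_isomorphic_canonical_CS[OF A])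

lemma CA_isomorphic_canonical_CA_iff:
  assumes P: "two_contact_space P" and Q: "two_contact_space Q"
  shows "CS_isomorphic P Q \<longleftrightarrow> CA_isomorphic (canonical_CA P) (canonical_CA Q)"
proof
  note T = two_contact_space_topological_pair
  show "CA_isomorphic (canonical_CA P) (canonical_CA Q)" if "CS_isomorphic P Q"
    using CA_isomorphic_canonical_CA[OF T[OF P] T[OF Q] that] .
  assume "CA_isomorphic (canonical_CA P) (canonical_CA Q)"
  then have "CS_isomorphic (canonical_CS (canonical_CA P)) (canonical_CS (canonical_CA Q))"
    using CS_isomorphic_canonical_CS two_contact_space_contact_algebra[OF P] by blast
  with CS_isomorphic_canonical_CS_canonical_CA[OF P]
  have "CS_isomorphic P (canonical_CS (canonical_CA Q))" by (rule CS_isomorphic_trans)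
  with CS_isomorphic_sym[OF T[OF Q] CS_isomorphic_canonical_CS_canonical_CA[OF Q]]
  show "CS_isomorphic P Q" by (blast intro: CS_isomorphic_trans)
qed

section \<open>The correspondence of isomorphism classes\<close>

lemma CA_isomorphic_refl: "CA_isomorphic A A"
  unfolding CA_isomorphic_def
  by (rule exI[of _ id], rule CA_isomorphismI) simp_all

lemma CA_isomorphic_canonical_CA_canonical_CS:
  assumes "contact_algebra B"
  shows "CA_isomorphic B (canonical_CA (canonical_CS B))"
    and "CA_isomorphic (canonical_CA (canonical_CS B)) B"
proof -
  interpret contact_algebra B by fact
  show "CA_isomorphic B (canonical_CA (canonical_CS B))"
    using clan_map_CA_isomorphism by (auto simp: CA_isomorphic_def)
  with assms show "CA_isomorphic (canonical_CA (canonical_CS B)) B"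
    by (rule CA_isomorphic_sym)
qed

lemma CS_isomorphic_canonical_CS_canonical_CA':
  assumes P: "two_contact_space P"
  shows "CS_isomorphic (canonical_CS (canonical_CA P)) P"
  using two_contact_space_topological_pair[OF P] CS_isomorphic_canonical_CS_canonical_CA[OF P]
  by (rule CS_isomorphic_sym)

text \<open>The relation "B corresponds to P" can be read on either side. The class correspondence
  rests on this symmetry, which connects a fixed algebra type with an unrelated space type.\<close>

lemma CA_CS_isomorphic_iff:
  assumes B: "contact_algebra B" and P: "two_contact_space P"
  shows "CA_isomorphic (canonical_CA P) B \<longleftrightarrow> CS_isomorphic (canonical_CS B) P"
proof
  note cP = two_contact_space_contact_algebra[OF P]
  assume "CA_isomorphic (canonical_CA P) B"
  with cP have "CA_isomorphic B (canonical_CA P)" by (rule CA_isomorphic_sym)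
  with B have "CS_isomorphic (canonical_CS B) (canonical_CS (canonical_CA P))"
    by (rule CS_isomorphic_canonical_CS)
  then show "CS_isomorphic (canonical_CS B) P"
    using CS_isomorphic_canonical_CS_canonical_CA'[OF P] by (rule CS_isomorphic_trans)
next
  have sB: "two_contact_space (canonical_CS B)"
    using B by (rule contact_algebra.two_contact_space_canonical_CS)
  assume "CS_isomorphic (canonical_CS B) P"
  then have "CA_isomorphic (canonical_CA (canonical_CS B)) (canonical_CA P)"
    using CA_isomorphic_canonical_CA_iff[OF sB P] by simp
  with CA_isomorphic_canonical_CA_canonical_CS(1)[OF B]
  have "CA_isomorphic B (canonical_CA P)" by (rule CA_isomorphic_trans)
  with B show "CA_isomorphic (canonical_CA P) B" by (rule CA_isomorphic_sym)
qed

lemma CA_class_cong: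
  assumes "contact_algebra A" "CA_isomorphic A A'"
  shows "(CA_class A :: 'b contact_alg set) = CA_class A'"
proof -
  have "CA_isomorphic A B \<longleftrightarrow> CA_isomorphic A' B" for B :: "'b contact_alg"
    using assms(2) CA_isomorphic_sym[OF assms] CA_isomorphic_trans[of A A' B]
      CA_isomorphic_trans[of A' A B] by blast
  then show ?thesis by (simp add: CA_class_def)
qed

lemma CS_class_cong:
  assumes "two_contact_space P" "CS_isomorphic P P'"
  shows "(CS_class P :: 'b top_pair set) = CS_class P'"
proof -
  have "CS_isomorphic P Q \<longleftrightarrow> CS_isomorphic P' Q" for Q :: "'b top_pair"
    using assms(2) CS_isomorphic_sym[OF two_contact_space_topological_pair[OF assms(1)] assms(2)]
      CS_isomorphic_trans[of P P' Q] CS_isomorphic_trans[of P' P Q] by blast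
  then show ?thesis by (simp add: CS_class_def)
qed

text \<open>All members of a class yield the same value, so the union just selects it without
  choosing a representative.\<close>

definition class_map :: "'a contact_alg set \<Rightarrow> 'b top_pair set"
  where "class_map c = (\<Union>B\<in>c. CS_class (canonical_CS B))"

text \<open>The representative may live on a third type \<open>'c\<close>, as
  \<open>canonical_CA P\<close> does. Nonemptiness matters because the union over an empty class
  would be empty.\<close>

lemma class_map_CA_class:
  fixes A :: "'c contact_alg"
  assumes A: "contact_algebra A" and ne: "(CA_class A :: 'a contact_alg set) \<noteq> {}"
  shows "class_map (CA_class A :: 'a contact_alg set) = (CS_class (canonical_CS A) :: 'b top_pair set)"
proof -
  have "CS_class (canonical_CS B) = (CS_class (canonical_CS A) :: 'b top_pair set)"
    if "B \<in> (CA_class A :: 'a contact_alg set)" for B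
  proof (rule sym, rule CS_class_cong)
    show "two_contact_space (canonical_CS A)"
      using A by (rule contact_algebra.two_contact_space_canonical_CS)
    show "CS_isomorphic (canonical_CS A) (canonical_CS B)"
      using that CS_isomorphic_canonical_CS[OF A, of B] by (simp add: CA_class_def)
  qed
  then show ?thesis using ne by (simp add: class_map_def)
qed

lemma CA_class_self: "contact_algebra B \<Longrightarrow> B \<in> CA_class B"
  by (simp add: CA_class_def CA_isomorphic_refl)

text \<open>Corresponding objects agree on \<open>p\<close> and \<open>q\<close>, so the
  correspondence restricts. Constantly true predicates give the full version,
  \<open>ca_connected\<close> and \<open>CS_connected\<close> the connected one.\<close>

lemma bij_betw_class_map:
  fixes p :: "'a contact_alg \<Rightarrow> bool" and q :: "'b top_pair \<Rightarrow> bool"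
  assumes pq: "\<And>B P. \<lbrakk>contact_algebra B; two_contact_space P; CS_isomorphic (canonical_CS B) P\<rbrakk>
    \<Longrightarrow> p B \<longleftrightarrow> q P"
  shows "bij_betw class_map (CA_class ` {B. B \<in> CAs_on TYPE('b) \<and> p B} :: 'a contact_alg set set)
    (CS_class ` {P. P \<in> CSs_on TYPE('a) \<and> q P} :: 'b top_pair set set)"
proof -
  define A where "A = {B :: 'a contact_alg. B \<in> CAs_on TYPE('b) \<and> p B}"
  define S where "S = {P :: 'b top_pair. P \<in> CSs_on TYPE('a) \<and> q P}"
  have map: "class_map (CA_class B :: 'a contact_alg set) = (CS_class (canonical_CS B) :: 'b top_pair set)"
    if "contact_algebra B" for B :: "'a contact_alg"
    using that CA_class_self[OF that] by (intro class_map_CA_class) auto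
  have sB: "two_contact_space (canonical_CS B)" if "contact_algebra B" for B :: "'a contact_alg"
    using that by (rule contact_algebra.two_contact_space_canonical_CS)
  show ?thesis
    unfolding bij_betw_def A_def[symmetric] S_def[symmetric]
  proof (intro conjI subset_antisym subsetI)
    show "inj_on (class_map :: 'a contact_alg set \<Rightarrow> 'b top_pair set) (CA_class ` A)"
    proof (rule inj_onI)
      fix c c' :: "'a contact_alg set"
      assume "c \<in> CA_class ` A" "c' \<in> CA_class ` A"
        and eq: "(class_map c :: 'b top_pair set) = class_map c'"
      then obtain B B' where B: "B \<in> A" "c = CA_class B" and B': "B' \<in> A" "c' = CA_class B'"
        by blast
      then have cB: "contact_algebra B" and cB': "contact_algebra B'"
        by (simp_all add: A_def CAs_on_def)
      \<comment> \<open>Membership in \<open>CAs_on\<close> provides a copy of the space on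
        \<open>'b\<close>. It belongs to both equal classes, so its canonical algebra is isomorphic
        to \<open>B\<close> and to \<open>B'\<close>.\<close>
      obtain Q :: "'b top_pair" where Q: "Q \<in> CS_class (canonical_CS B)"
        using B(1) by (auto simp: A_def CAs_on_def)
      also have "CS_class (canonical_CS B) = (CS_class (canonical_CS B') :: 'b top_pair set)"
        using eq unfolding B(2) B'(2) map[OF cB] map[OF cB'] .
      finally have "CA_isomorphic (canonical_CA Q) B" "CA_isomorphic (canonical_CA Q) B'"
        and cQ: "contact_algebra (canonical_CA Q)"
        using Q CA_CS_isomorphic_iff[OF cB, of Q] CA_CS_isomorphic_iff[OF cB', of Q]
        by (simp_all add: CS_class_def two_contact_space_contact_algebra)
      then show "c = c'"
        unfolding B(2) B'(2) using CA_class_cong[OF cQ] by metis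
    qed
  next
    fix d :: "'b top_pair set"
    assume "d \<in> class_map ` (CA_class ` A :: 'a contact_alg set set)"
    then obtain B where B: "B \<in> A" "d = class_map (CA_class B :: 'a contact_alg set)" by blast
    then have cB: "contact_algebra B" by (simp add: A_def CAs_on_def)
    obtain Q :: "'b top_pair" where "Q \<in> CS_class (canonical_CS B)"
      using B(1) by (auto simp: A_def CAs_on_def)
    then have Q: "two_contact_space Q" "CS_isomorphic (canonical_CS B) Q"
      by (simp_all add: CS_class_def)
    have "B \<in> CA_class (canonical_CA Q)"
      using cB CA_CS_isomorphic_iff[OF cB Q(1)] Q(2) by (simp add: CA_class_def)
    then have "Q \<in> S" using Q(1) pq[OF cB Q] B(1) by (auto simp: A_def S_def CSs_on_def)
    moreover have "d = CS_class Q"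
      unfolding B(2) map[OF cB] using sB[OF cB] Q(2) by (rule CS_class_cong)
    ultimately show "d \<in> CS_class ` S" by blast
  next
    fix d :: "'b top_pair set"
    assume "d \<in> CS_class ` S"
    then obtain P :: "'b top_pair" where P: "P \<in> S" "d = CS_class P" by blast
    then have tP: "two_contact_space P" by (simp add: S_def CSs_on_def)
    \<comment> \<open>The preimage is a copy on \<open>'a\<close> of the canonical algebra of
      \<open>P\<close>, available by \<open>CSs_on\<close>.\<close>
    obtain B :: "'a contact_alg" where "B \<in> CA_class (canonical_CA P)"
      using P(1) by (auto simp: S_def CSs_on_def)
    then have cB: "contact_algebra B" and iso: "CS_isomorphic (canonical_CS B) P"
      using CA_CS_isomorphic_iff[OF _ tP] by (auto simp: CA_class_def)
    have "P \<in> CS_class (canonical_CS B)" using tP iso by (simp add: CS_class_def)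
    then have "B \<in> A" using cB pq[OF cB tP iso] P(1) by (auto simp: S_def A_def CAs_on_def)
    moreover have "d = class_map (CA_class B :: 'a contact_alg set)"
      unfolding P(2) map[OF cB] by (rule CS_class_cong[OF sB[OF cB] iso, symmetric])
    ultimately show "d \<in> class_map ` (CA_class ` A :: 'a contact_alg set set)" by blast
  qed
qed

lemma ca_connected_iff_CS_connected:
  assumes B: "contact_algebra B" and P: "two_contact_space P"
    and iso: "CS_isomorphic (canonical_CS B) P"
  shows "ca_connected B \<longleftrightarrow> CS_connected P"
proof -
  have cP: "contact_algebra (canonical_CA P)" using P by (rule two_contact_space_contact_algebra)
  have i: "CA_isomorphic (canonical_CA P) B" using CA_CS_isomorphic_iff[OF B P] iso by simp
  then have "ca_connected B \<longleftrightarrow> ca_connected (canonical_CA P)"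
    using ca_connected_iso[OF cP i] ca_connected_iso[OF B CA_isomorphic_sym[OF cP i]] by blast
  then show ?thesis using CS_connected_iff[OF two_contact_space_topological_pair[OF P]] by simp
qed

lemma CS_connected_canonical_CS_iff:
  assumes B: "contact_algebra B"
  shows "ca_connected B \<longleftrightarrow> CS_connected (canonical_CS B)"
proof (rule ca_connected_iff_CS_connected[OF B])
  show S: "two_contact_space (canonical_CS B)"
    using B by (rule contact_algebra.two_contact_space_canonical_CS)
  show "CS_isomorphic (canonical_CS B) (canonical_CS B)"
    using CS_isomorphic_canonical_CS[OF B CA_isomorphic_refl] .
qed

text \<open>The general criterion speaks about the canonical algebra of the pair; completeness then
  moves between that algebra and \<open>B\<close> along isomorphisms in both directions.\<close>

lemma RC_pair_canonical_CS_eq_RC_iff: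
  assumes B: "contact_algebra B"
  shows "RC_pair (canonical_CS B) = RC (fst (canonical_CS B)) \<longleftrightarrow> ba_complete B"
proof -
  interpret contact_algebra B by (rule B)
  let ?P = "canonical_CS B"
  have P: "two_contact_space (clan_topology B, Ult B)"
    using two_contact_space_canonical_CS by (simp add: canonical_CS_def)
  have "RC_pair ?P = RC (fst ?P) \<longleftrightarrow> ba_complete (canonical_CA ?P)"
    using RC_pair_eq_RC_iff[OF two_contact_spaceD(1,4)[OF P]] by (simp add: canonical_CS_def)
  moreover have "contact_algebra (canonical_CA ?P)"
    using two_contact_space_canonical_CS by (rule two_contact_space_contact_algebra)
  ultimately show ?thesis
    using ba_complete_iso[OF B CA_isomorphic_canonical_CA_canonical_CS(1)[OF B]]
      ba_complete_iso[OF _ CA_isomorphic_canonical_CA_canonical_CS(2)[OF B]] by blast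
qed

theorem theorem7p9:
  shows
   "(\<forall>B :: 'a contact_alg. contact_algebra B \<longrightarrow>
       CA_isomorphism (clan_map B) B (canonical_CA (canonical_CS B)) \<and>
       (RC_pair (canonical_CS B) = RC (fst (canonical_CS B)) \<longleftrightarrow> ba_complete B) \<and>
       (ca_connected B \<longleftrightarrow> CS_connected (canonical_CS B)))
    \<and>
    (\<forall>B :: 'a contact_alg. contact_algebra B \<longrightarrow>
       two_contact_space (canonical_CS B) \<and>
       CA_isomorphic (canonical_CA (canonical_CS B)) B \<and>
       (ca_connected B \<longrightarrow> CS_connected (canonical_CS B)))
    \<and>
    (\<forall>P :: 'b top_pair. two_contact_space P \<longrightarrow>
       contact_algebra (canonical_CA P) \<and>
       CS_isomorphic (canonical_CS (canonical_CA P)) P \<and>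
       (CS_connected P \<longrightarrow> ca_connected (canonical_CA P)))
    \<and>
    (\<forall>(B :: 'a contact_alg) (B' :: 'c contact_alg). contact_algebra B \<and> contact_algebra B' \<longrightarrow>
       (CA_isomorphic B B' \<longleftrightarrow> CS_isomorphic (canonical_CS B) (canonical_CS B')))
    \<and>
    (\<forall>(P :: 'b top_pair) (P' :: 'd top_pair). two_contact_space P \<and> two_contact_space P' \<longrightarrow>
       (CS_isomorphic P P' \<longleftrightarrow> CA_isomorphic (canonical_CA P) (canonical_CA P')))
    \<and>
    (\<exists>\<Phi> :: 'a contact_alg set \<Rightarrow> 'b top_pair set.
       bij_betw \<Phi> (CA_class ` (CAs_on TYPE('b) :: 'a contact_alg set))
                  (CS_class ` (CSs_on TYPE('a) :: 'b top_pair set)) \<and>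
       bij_betw \<Phi> (CA_class ` {B :: 'a contact_alg. B \<in> CAs_on TYPE('b) \<and> ca_connected B})
                  (CS_class ` {P :: 'b top_pair. P \<in> CSs_on TYPE('a) \<and> CS_connected P}) \<and>
       (\<forall>B \<in> (CAs_on TYPE('b) :: 'a contact_alg set).
          \<Phi> (CA_class B) = CS_class (canonical_CS B)) \<and>
       (\<forall>P \<in> (CSs_on TYPE('a) :: 'b top_pair set).
          \<Phi> (CA_class (canonical_CA P)) = CS_class P))"
proof (intro conjI allI impI; (elim conjE)?)
  fix B :: "'a contact_alg" assume B: "contact_algebra B"
  interpret contact_algebra B by (rule B)
  show "CA_isomorphism (clan_map B) B (canonical_CA (canonical_CS B))"
    by (rule clan_map_CA_isomorphism)
  show "RC_pair (canonical_CS B) = RC (fst (canonical_CS B)) \<longleftrightarrow> ba_complete B"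
    using B by (rule RC_pair_canonical_CS_eq_RC_iff)
  show "ca_connected B \<longleftrightarrow> CS_connected (canonical_CS B)"
    using B by (rule CS_connected_canonical_CS_iff)
  then show "CS_connected (canonical_CS B)" if "ca_connected B" using that by blast
  show "two_contact_space (canonical_CS B)" by (rule two_contact_space_canonical_CS)
  show "CA_isomorphic (canonical_CA (canonical_CS B)) B"
    using B by (rule CA_isomorphic_canonical_CA_canonical_CS)
next
  fix P :: "'b top_pair" assume P: "two_contact_space P"
  show "contact_algebra (canonical_CA P)" using P by (rule two_contact_space_contact_algebra)
  show "CS_isomorphic (canonical_CS (canonical_CA P)) P"
    using P by (rule CS_isomorphic_canonical_CS_canonical_CA')
  show "ca_connected (canonical_CA P)" if "CS_connected P"
    using that CS_connected_iff[OF two_contact_space_topological_pair[OF P]] by simp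
next
  fix B :: "'a contact_alg" and B' :: "'c contact_alg"
  assume "contact_algebra B" "contact_algebra B'"
  then show "CA_isomorphic B B' \<longleftrightarrow> CS_isomorphic (canonical_CS B) (canonical_CS B')"
    by (rule CS_isomorphic_canonical_CS_iff)
next
  fix P :: "'b top_pair" and P' :: "'d top_pair"
  assume "two_contact_space P" "two_contact_space P'"
  then show "CS_isomorphic P P' \<longleftrightarrow> CA_isomorphic (canonical_CA P) (canonical_CA P')"
    by (rule CA_isomorphic_canonical_CA_iff)
next
  let ?\<Phi> = "class_map :: 'a contact_alg set \<Rightarrow> 'b top_pair set"
  show "\<exists>\<Phi> :: 'a contact_alg set \<Rightarrow> 'b top_pair set.
       bij_betw \<Phi> (CA_class ` (CAs_on TYPE('b) :: 'a contact_alg set))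
                  (CS_class ` (CSs_on TYPE('a) :: 'b top_pair set)) \<and>
       bij_betw \<Phi> (CA_class ` {B :: 'a contact_alg. B \<in> CAs_on TYPE('b) \<and> ca_connected B})
                  (CS_class ` {P :: 'b top_pair. P \<in> CSs_on TYPE('a) \<and> CS_connected P}) \<and>
       (\<forall>B \<in> (CAs_on TYPE('b) :: 'a contact_alg set).
          \<Phi> (CA_class B) = CS_class (canonical_CS B)) \<and>
       (\<forall>P \<in> (CSs_on TYPE('a) :: 'b top_pair set).
          \<Phi> (CA_class (canonical_CA P)) = CS_class P)"
  proof (intro exI[of _ ?\<Phi>] conjI ballI)
    show "bij_betw ?\<Phi> (CA_class ` (CAs_on TYPE('b) :: 'a contact_alg set))
        (CS_class ` (CSs_on TYPE('a) :: 'b top_pair set))"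
      using bij_betw_class_map[of "\<lambda>_ :: 'a contact_alg. True" "\<lambda>_ :: 'b top_pair. True"] by simp
    show "bij_betw ?\<Phi> (CA_class ` {B :: 'a contact_alg. B \<in> CAs_on TYPE('b) \<and> ca_connected B})
        (CS_class ` {P :: 'b top_pair. P \<in> CSs_on TYPE('a) \<and> CS_connected P})"
      by (rule bij_betw_class_map) (rule ca_connected_iff_CS_connected)
    show "?\<Phi> (CA_class B) = CS_class (canonical_CS B)" if "B \<in> CAs_on TYPE('b)" for B :: "'a contact_alg"
    proof (rule class_map_CA_class)
      show "contact_algebra B" using that by (simp add: CAs_on_def)
      then show "(CA_class B :: 'a contact_alg set) \<noteq> {}" using CA_class_self by blast
    qed
    show "?\<Phi> (CA_class (canonical_CA P)) = CS_class P" if "P \<in> CSs_on TYPE('a)" for P :: "'b top_pair"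
    proof -
      have P: "two_contact_space P" and ne: "(CA_class (canonical_CA P) :: 'a contact_alg set) \<noteq> {}"
        using that by (simp_all add: CSs_on_def)
      have cP: "contact_algebra (canonical_CA P)" using P by (rule two_contact_space_contact_algebra)
      have "CS_class P = (CS_class (canonical_CS (canonical_CA P)) :: 'b top_pair set)"
        using P CS_isomorphic_canonical_CS_canonical_CA[OF P] by (rule CS_class_cong)
      then show ?thesis by (simp add: class_map_CA_class[OF cP ne])
    qed
  qed
qed

end
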